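(* Let $\Sigma=\{x_1,\dots,x_m\}$ and $\Delta=\{y_1,\dots,y_k\}$ be fixed finite alphabets with $m\leq k$. Then, generically (with probability $1$), a pair of homomorphisms $g,h:F(\Sigma)\to F(\Delta)$ is an instance of $\mathrm{PCP}^{\mathrm{inj}+\mathrm{CI}}$; in particular it is conjugacy inequivalent. Explicitly: among all $2m$-tuples $(a_1,\dots,a_m,b_1,\dots,b_m)$ of elements of $F(\Delta)$ of word length at most $n$, the proportion of those for which the homomorphisms $g,h$ defined by $g(x_i)=a_i$, $h(x_i)=b_i$ ($1\le i\le m$) form an instance of $\mathrm{PCP}^{\mathrm{inj}+\mathrm{CI}}$ tends to $1$ as $n\to\infty$.
   Context: $F(\Sigma)$ is the free group on $\Sigma$, and word length in $F(\Delta)$ is the length of the freely reduced word over $\Delta^{\pm1}$. A pair $g,h:F(\Sigma)\to F(\Delta)$ is conjugacy inequivalent if for every $u\in F(\Delta)$ there is no $x\in F(\Sigma)\setminus\{1\}$ with $g(x)=u^{-1}h(x)u$. A pair $g,h$ is an instance of $\mathrm{PCP}^{\mathrm{inj}+\mathrm{CI}}$ if at least one of $g,h$ is injective and the pair is conjugacy inequivalent. *)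

theory Defs
  imports Complex_Main "HOL-Library.FuncSet" "HOL-Algebra.Group"
begin

section \<open>Free groups\<close>

text \<open>
  A letter \<open>(x, True)\<close> stands for the generator \<open>x\<close> and \<open>(x, False)\<close> for its formal inverse.
  Elements of the free group are represented by their freely reduced words, so that the word
  length of an element is the \<open>length\<close> of the list representing it.
\<close>

type_synonym 'a word = "('a \<times> bool) list"

definition inv_letter :: "'a \<times> bool \<Rightarrow> 'a \<times> bool" where
  "inv_letter l = (fst l, \<not> snd l)"

definition freely_reduced :: "'a word \<Rightarrow> bool" where
  "freely_reduced w \<longleftrightarrow> successively (\<lambda>l l'. l' \<noteq> inv_letter l) w"

fun cancel_cons :: "'a \<times> bool \<Rightarrow> 'a word \<Rightarrow> 'a word" where
  "cancel_cons l [] = [l]"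
| "cancel_cons l (l' # w) = (if l' = inv_letter l then w else l # l' # w)"

definition free_reduce :: "'a word \<Rightarrow> 'a word" where
  "free_reduce w = foldr cancel_cons w []"

definition free_group :: "'a set \<Rightarrow> 'a word monoid" where
  "free_group S =
    \<lparr>carrier = {w. set w \<subseteq> S \<times> UNIV \<and> freely_reduced w},
     mult = (\<lambda>u v. free_reduce (u @ v)),
     one = []\<rparr>"

definition free_gen :: "'a \<Rightarrow> 'a word" where
  "free_gen x = [(x, True)]"

text \<open>
  The homomorphism out of a free group determined by the images \<open>a x\<close> of the generators
  (see \<open>free_ext_hom\<close>, \<open>free_ext_gen\<close> and \<open>free_ext_unique\<close> below).
\<close>

definition free_ext :: "('b, 'c) monoid_scheme \<Rightarrow> ('a \<Rightarrow> 'b) \<Rightarrow> 'a word \<Rightarrow> 'b" where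
  "free_ext G a w =
    foldr (\<lambda>(x, p) r. (if p then a x else inv\<^bsub>G\<^esub> (a x)) \<otimes>\<^bsub>G\<^esub> r) w \<one>\<^bsub>G\<^esub>"

definition word_ball :: "'a set \<Rightarrow> nat \<Rightarrow> 'a word set" where
  "word_ball S n = {w \<in> carrier (free_group S). length w \<le> n}"


section \<open>Instances of the Post correspondence problem\<close>

definition conjugacy_inequivalent ::
    "'a set \<Rightarrow> 'b set \<Rightarrow> ('a word \<Rightarrow> 'b word) \<Rightarrow> ('a word \<Rightarrow> 'b word) \<Rightarrow> bool" where
  "conjugacy_inequivalent S D g h \<longleftrightarrow>
    (\<forall>u \<in> carrier (free_group D).
      \<not> (\<exists>x \<in> carrier (free_group S) - {\<one>\<^bsub>free_group S\<^esub>}.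
          g x = inv\<^bsub>free_group D\<^esub> u \<otimes>\<^bsub>free_group D\<^esub> h x \<otimes>\<^bsub>free_group D\<^esub> u))"

definition PCP_inj_CI ::
    "'a set \<Rightarrow> 'b set \<Rightarrow> ('a word \<Rightarrow> 'b word) \<Rightarrow> ('a word \<Rightarrow> 'b word) \<Rightarrow> bool" where
  "PCP_inj_CI S D g h \<longleftrightarrow>
    g \<in> hom (free_group S) (free_group D) \<and>
    h \<in> hom (free_group S) (free_group D) \<and>
    (inj_on g (carrier (free_group S)) \<or> inj_on h (carrier (free_group S))) \<and>
    conjugacy_inequivalent S D g h"

text \<open>
  A \<open>2m\<close>-tuple \<open>(a\<^sub>1, \<dots>, a\<^sub>m, b\<^sub>1, \<dots>, b\<^sub>m)\<close> is a pair of functions on the alphabet \<open>S\<close> with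
  \<open>card S = m\<close>; extensionality makes each tuple count exactly once.
\<close>

definition image_tuples :: "'a set \<Rightarrow> 'b set \<Rightarrow> nat \<Rightarrow> (('a \<Rightarrow> 'b word) \<times> ('a \<Rightarrow> 'b word)) set" where
  "image_tuples S D n = (S \<rightarrow>\<^sub>E word_ball D n) \<times> (S \<rightarrow>\<^sub>E word_ball D n)"

definition proportion ::
    "'a set \<Rightarrow> 'b set \<Rightarrow> (('a word \<Rightarrow> 'b word) \<Rightarrow> ('a word \<Rightarrow> 'b word) \<Rightarrow> bool) \<Rightarrow> nat \<Rightarrow> real" where
  "proportion S D P n =
    real (card {(a, b) \<in> image_tuples S D n.
                  P (free_ext (free_group D) a) (free_ext (free_group D) b)})
    / real (card (image_tuples S D n))"


section \<open>Basic facts\<close>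

lemma inv_letter_inv_letter [simp]: "inv_letter (inv_letter l) = l"
  by (simp add: inv_letter_def)

lemma inv_letter_neq [simp]: "inv_letter l \<noteq> l" "l \<noteq> inv_letter l"
  by (auto simp: inv_letter_def prod_eq_iff)

lemma freely_reduced_Nil [simp]: "freely_reduced []"
  by (simp add: freely_reduced_def)

lemma freely_reduced_Cons:
  "freely_reduced (l # w) \<longleftrightarrow> freely_reduced w \<and> (w = [] \<or> hd w \<noteq> inv_letter l)"
  by (cases w) (auto simp: freely_reduced_def)

lemma freely_reduced_cancel_cons: "freely_reduced w \<Longrightarrow> freely_reduced (cancel_cons l w)"
  by (cases w) (auto simp: freely_reduced_Cons)

lemma freely_reduced_foldr: "freely_reduced w \<Longrightarrow> freely_reduced (foldr cancel_cons u w)"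
  by (induction u) (auto intro: freely_reduced_cancel_cons)

lemma freely_reduced_free_reduce: "freely_reduced (free_reduce w)"
  by (simp add: free_reduce_def freely_reduced_foldr)

lemma cancel_cons_inv: "freely_reduced w \<Longrightarrow> cancel_cons l (cancel_cons (inv_letter l) w) = w"
proof (cases w)
  case (Cons l' v)
  assume "freely_reduced w"
  with Cons show ?thesis
    by (cases v) (auto simp: freely_reduced_Cons)
qed simp

lemma foldr_cancel_cons:
  assumes "freely_reduced w"
  shows "foldr cancel_cons (cancel_cons l v) w = cancel_cons l (foldr cancel_cons v w)"
  using assms by (cases v) (auto simp: cancel_cons_inv freely_reduced_foldr)

lemma foldr_free_reduce:
  assumes "freely_reduced w"
  shows "foldr cancel_cons (free_reduce u) w = foldr cancel_cons u w"
  by (induction u) (use assms in \<open>auto simp: free_reduce_def foldr_cancel_cons\<close>)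

lemma free_reduce_append: "free_reduce (u @ v) = foldr cancel_cons u (free_reduce v)"
  by (simp add: free_reduce_def)

lemma free_reduce_id: "freely_reduced w \<Longrightarrow> free_reduce w = w"
proof (induction w)
  case (Cons l w)
  then show ?case
    by (cases w) (auto simp: free_reduce_def freely_reduced_Cons)
qed (simp add: free_reduce_def)

lemma free_reduce_free_reduce_left: "free_reduce (free_reduce u @ v) = free_reduce (u @ v)"
  by (simp add: free_reduce_append foldr_free_reduce freely_reduced_free_reduce)

lemma free_reduce_free_reduce_right: "free_reduce (u @ free_reduce v) = free_reduce (u @ v)"
  by (simp add: free_reduce_append free_reduce_id freely_reduced_free_reduce)

lemma set_cancel_cons: "set (cancel_cons l w) \<subseteq> insert l (set w)"
  by (cases w) auto

lemma set_free_reduce: "set (free_reduce w) \<subseteq> set w"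
  unfolding free_reduce_def
  by (induction w) (use set_cancel_cons in fastforce)+

lemma free_reduce_inverse: "free_reduce (rev (map inv_letter w) @ w) = []"
proof (induction w)
  case (Cons l w)
  have "cancel_cons (inv_letter l) (cancel_cons l (free_reduce w)) = free_reduce w"
    using cancel_cons_inv[OF freely_reduced_free_reduce, of "inv_letter l"] by simp
  with Cons show ?case
    by (simp add: free_reduce_def)
qed (simp add: free_reduce_def)

lemma group_free_group: "group (free_group S)"
proof (rule groupI)
  fix u assume u: "u \<in> carrier (free_group S)"
  let ?v = "free_reduce (rev (map inv_letter u))"
  have "set (rev (map inv_letter u)) \<subseteq> S \<times> UNIV"
    using u by (auto simp: free_group_def inv_letter_def)
  then have "?v \<in> carrier (free_group S)"
    using set_free_reduce by (fastforce simp: free_group_def freely_reduced_free_reduce)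
  moreover have "?v \<otimes>\<^bsub>free_group S\<^esub> u = \<one>\<^bsub>free_group S\<^esub>"
    by (simp add: free_group_def free_reduce_free_reduce_left free_reduce_inverse)
  ultimately show "\<exists>v \<in> carrier (free_group S). v \<otimes>\<^bsub>free_group S\<^esub> u = \<one>\<^bsub>free_group S\<^esub>"
    by blast
next
  fix u v
  assume "u \<in> carrier (free_group S)" "v \<in> carrier (free_group S)"
  then have "set (u @ v) \<subseteq> S \<times> UNIV" by (auto simp: free_group_def)
  with set_free_reduce[of "u @ v"] show "u \<otimes>\<^bsub>free_group S\<^esub> v \<in> carrier (free_group S)"
    unfolding free_group_def
    by (simp add: freely_reduced_free_reduce del: set_append)
qed (auto simp: free_group_def free_reduce_free_reduce_left free_reduce_free_reduce_right
       free_reduce_id)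

lemma free_gen_in_carrier: "x \<in> S \<Longrightarrow> free_gen x \<in> carrier (free_group S)"
  by (simp add: free_group_def free_gen_def freely_reduced_Cons)

context
  fixes G :: "('b, 'c) monoid_scheme" (structure) and S :: "'a set" and a :: "'a \<Rightarrow> 'b"
  assumes group_G: "group G" and a_in: "a \<in> S \<rightarrow> carrier G"
begin

interpretation group G by (rule group_G)

lemma free_ext_closed: "set w \<subseteq> S \<times> UNIV \<Longrightarrow> free_ext G a w \<in> carrier G"
proof (induction w)
  case (Cons l w)
  then show ?case
    using a_in by (cases l) (auto simp: free_ext_def)
qed (simp add: free_ext_def)

lemma free_ext_cancel_cons:
  assumes "fst l \<in> S" "set w \<subseteq> S \<times> UNIV"
  shows "free_ext G a (cancel_cons l w) = free_ext G a (l # w)"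
proof (cases w)
  case (Cons l' v)
  have "a (fst l) \<in> carrier G" using a_in assms by auto
  moreover have "free_ext G a v \<in> carrier G" using free_ext_closed assms Cons by auto
  ultimately show ?thesis using Cons
    by (cases l) (auto simp: free_ext_def inv_letter_def m_assoc[symmetric])
qed simp

lemma free_ext_free_reduce:
  "set w \<subseteq> S \<times> UNIV \<Longrightarrow> free_ext G a (free_reduce w) = free_ext G a w"
proof (induction w)
  case (Cons l w)
  have "set (free_reduce w) \<subseteq> S \<times> UNIV" using Cons.prems set_free_reduce[of w] by auto
  then have "free_ext G a (free_reduce (l # w)) = free_ext G a (l # free_reduce w)"
    using Cons.prems free_ext_cancel_cons[of l "free_reduce w"] by (auto simp: free_reduce_def)
  also have "\<dots> = free_ext G a (l # w)"
    using Cons by (simp add: free_ext_def)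
  finally show ?case .
qed (simp add: free_reduce_def)

lemma free_ext_append:
  "set u \<subseteq> S \<times> UNIV \<Longrightarrow> set v \<subseteq> S \<times> UNIV \<Longrightarrow>
    free_ext G a (u @ v) = free_ext G a u \<otimes> free_ext G a v"
proof (induction u)
  case Nil
  then show ?case using free_ext_closed[of v] by (simp add: free_ext_def)
next
  case (Cons l u)
  have "a (fst l) \<in> carrier G" using a_in Cons by auto
  moreover have "free_ext G a u \<in> carrier G" "free_ext G a v \<in> carrier G"
    using free_ext_closed Cons by auto
  ultimately show ?case using Cons
    by (cases l) (auto simp: free_ext_def m_assoc)
qed

lemma free_ext_hom: "free_ext G a \<in> hom (free_group S) G"
proof (rule homI)
  fix u v assume "u \<in> carrier (free_group S)" "v \<in> carrier (free_group S)"
  then show "free_ext G a (u \<otimes>\<^bsub>free_group S\<^esub> v) = free_ext G a u \<otimes> free_ext G a v"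
    using free_ext_free_reduce[of "u @ v"] free_ext_append[of u v] by (simp add: free_group_def)
qed (simp add: free_group_def free_ext_closed)

lemma free_ext_gen: "x \<in> S \<Longrightarrow> free_ext G a (free_gen x) = a x"
  using a_in funcset_mem[OF a_in] by (simp add: free_ext_def free_gen_def)

lemma free_ext_unique:
  assumes g: "g \<in> hom (free_group S) G" and gen: "\<And>x. x \<in> S \<Longrightarrow> g (free_gen x) = a x"
    and "w \<in> carrier (free_group S)"
  shows "g w = free_ext G a w"
proof -
  interpret g: group_hom "free_group S" G g
    using g group_free_group group_G by (simp add: group_hom_def group_hom_axioms_def)
  have letter: "g [l] = (if snd l then a (fst l) else inv (a (fst l)))" if "fst l \<in> S" for l
  proof (cases "snd l")
    case True
    then show ?thesis using gen[OF that] by (cases l) (simp add: free_gen_def)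
  next
    case False
    have "inv\<^bsub>free_group S\<^esub> (free_gen (fst l)) = [l]"
    proof (rule g.G.inv_equality)
      show "[l] \<otimes>\<^bsub>free_group S\<^esub> free_gen (fst l) = \<one>\<^bsub>free_group S\<^esub>"
        using False by (cases l) (simp add: free_group_def free_gen_def free_reduce_def inv_letter_def)
      show "[l] \<in> carrier (free_group S)"
        using that by (cases l) (simp add: free_group_def freely_reduced_Cons)
    qed (rule free_gen_in_carrier[OF that])
    then show ?thesis
      using False gen[OF that] g.hom_inv[OF free_gen_in_carrier[OF that]] by simp
  qed
  from assms(3) show ?thesis
  proof (induction w)
    case Nil
    then show ?case using g.hom_one by (simp add: free_group_def free_ext_def)
  next
    case (Cons l w)
    have l: "fst l \<in> S" and w: "w \<in> carrier (free_group S)"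
      and l': "[l] \<in> carrier (free_group S)"
      using Cons.prems by (auto simp: free_group_def freely_reduced_Cons)
    have "[l] \<otimes>\<^bsub>free_group S\<^esub> w = l # w"
      using Cons.prems by (simp add: free_group_def free_reduce_id)
    then have "g (l # w) = g [l] \<otimes> g w"
      using g.hom_mult[OF l' w] by simp
    also have "\<dots> = free_ext G a (l # w)"
      using Cons.IH[OF w] letter[OF l] by (cases l) (simp add: free_ext_def)
    finally show ?case .
  qed
qed

end

lemma finite_word_ball: "finite D \<Longrightarrow> finite (word_ball D n)"
  by (rule finite_subset[OF _ finite_lists_length_le[of "D \<times> (UNIV :: bool set)" n]])
     (auto simp: word_ball_def free_group_def)

lemma Nil_in_word_ball: "[] \<in> word_ball D n"
  by (simp add: word_ball_def free_group_def)

lemma card_image_tuples_pos: "finite S \<Longrightarrow> finite D \<Longrightarrow> card (image_tuples S D n) > 0"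
  using Nil_in_word_ball[of D n]
  by (auto simp: image_tuples_def card_gt_0_iff PiE_eq_empty_iff
      intro!: finite_cartesian_product finite_PiE finite_word_ball)

end

theory Submission
  imports Defs "HOL-Library.Sublist" "HOL-Real_Asymp.Real_Asymp"
begin

text \<open>
  Let \<open>D\<close> have at least two letters and put \<open>L = n div 8\<close>. Generically the images of the generators
  have length at least \<open>4 * L\<close>, the images of distinct signed letters under \<open>g\<close> differ in their first \<open>L\<close>
  letters (likewise for \<open>h\<close>), and no image under \<open>g\<close> shares a factor of length \<open>L\<close> with an image
  under \<open>h\<close> or its inverse: each violation fixes \<open>L\<close> letters of some coordinate, given the others,
  up to polynomially many choices.
  Then less than \<open>L\<close> letters cancel between consecutive images, so the reduced word of \<open>g x\<close> is a
  concatenation of long factors of images of letters; in particular \<open>g\<close> is injective. If \<open>g x\<close>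
  and \<open>h x\<close> were conjugate, then reduced words of large powers would share a long factor, and some
  piece of length \<open>L\<close> of it would lie inside one image under \<open>g\<close> and one image under \<open>h\<close>.
  If \<open>D\<close> has at most one letter, the exponent sum reduces everything to multiplication in the
  integers.
\<close>

section \<open>Formal inverses and cancellation in products of reduced words\<close>

definition inv_word :: "'a word \<Rightarrow> 'a word" where
  "inv_word w = rev (map inv_letter w)"

lemma length_inv_word [simp]: "length (inv_word w) = length w"
  by (simp add: inv_word_def)

lemma inv_word_Nil [simp]: "inv_word [] = []"
  by (simp add: inv_word_def)

lemma inv_word_append [simp]: "inv_word (u @ v) = inv_word v @ inv_word u"
  by (simp add: inv_word_def)

lemma inv_word_inv_word [simp]: "inv_word (inv_word w) = w"
  by (simp add: inv_word_def rev_map comp_def)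

lemma sublist_inv_word: "sublist u v \<Longrightarrow> sublist (inv_word u) (inv_word v)"
  unfolding sublist_def by (metis inv_word_append append.assoc)

lemma freely_reduced_append:
  "freely_reduced (u @ v) \<longleftrightarrow> freely_reduced u \<and> freely_reduced v \<and>
    (u = [] \<or> v = [] \<or> hd v \<noteq> inv_letter (last u))"
  by (auto simp: freely_reduced_def successively_append_iff)

lemma freely_reduced_inv_word [simp]: "freely_reduced (inv_word w) \<longleftrightarrow> freely_reduced w"
proof -
  have "(\<lambda>x y. y \<noteq> inv_letter x) = (\<lambda>x y. inv_letter x \<noteq> inv_letter (inv_letter y))"
    by (auto simp: fun_eq_iff)
  then show ?thesis
    unfolding freely_reduced_def inv_word_def successively_rev successively_map
    by (smt (verit) inv_letter_inv_letter successively_cong)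
qed

lemma carrier_free_group: "w \<in> carrier (free_group S) \<longleftrightarrow> set w \<subseteq> S \<times> UNIV \<and> freely_reduced w"
  by (simp add: free_group_def)

lemma mult_free_group: "u \<otimes>\<^bsub>free_group S\<^esub> v = free_reduce (u @ v)"
  by (simp add: free_group_def)

lemma one_free_group: "\<one>\<^bsub>free_group S\<^esub> = []"
  by (simp add: free_group_def)

lemma append_in_carrierD:
  "u @ v \<in> carrier (free_group S) \<Longrightarrow> u \<in> carrier (free_group S) \<and> v \<in> carrier (free_group S)"
  by (auto simp: carrier_free_group freely_reduced_append)

lemma inv_word_in_carrier:
  "w \<in> carrier (free_group S) \<Longrightarrow> inv_word w \<in> carrier (free_group S)"
  by (force simp: carrier_free_group inv_word_def[of w] inv_letter_def simp flip: freely_reduced_inv_word[of w])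

lemma inv_free_group:
  assumes "w \<in> carrier (free_group S)"
  shows "inv\<^bsub>free_group S\<^esub> w = inv_word w"
proof (rule group.inv_equality[OF group_free_group])
  show "inv_word w \<otimes>\<^bsub>free_group S\<^esub> w = \<one>\<^bsub>free_group S\<^esub>"
    by (simp add: mult_free_group one_free_group inv_word_def free_reduce_inverse)
qed (use assms inv_word_in_carrier in auto)

text \<open>Two reduced words cancel only at their junction. Induction removes the last letter of
  \<open>u\<close> against the first letter of \<open>v\<close> as long as they are mutually
  inverse, which collects the cancelled suffix \<open>c\<close>.\<close>

lemma free_reduce_append_cases:
  assumes "freely_reduced u" "freely_reduced v"
  obtains p c s where "u = p @ c" "v = inv_word c @ s" "free_reduce (u @ v) = p @ s"
    "freely_reduced (p @ s)"
proof -
  have "\<exists>p c s. u = p @ c \<and> v = inv_word c @ s \<and> free_reduce (u @ v) = p @ s \<and> freely_reduced (p @ s)"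
    using assms
  proof (induction u arbitrary: v rule: rev_induct)
    case Nil
    then show ?case by (auto simp: free_reduce_id)
  next
    case (snoc l u)
    show ?case
    proof (cases "v \<noteq> [] \<and> hd v = inv_letter l")
      case True
      then obtain v' where v: "v = inv_letter l # v'" by (cases v) auto
      have "freely_reduced v'" "freely_reduced u"
        using snoc.prems v by (auto simp: freely_reduced_Cons freely_reduced_append)
      then obtain p c s where *: "u = p @ c" "v' = inv_word c @ s"
          "free_reduce (u @ v') = p @ s" "freely_reduced (p @ s)"
        using snoc.IH by blast
      have "free_reduce ((u @ [l]) @ v) = free_reduce (u @ v')"
        using v snoc.prems \<open>freely_reduced v'\<close>
        by (simp add: free_reduce_append[of "u @ [l]"] free_reduce_append[of u] free_reduce_id del: append_assoc)
      then show ?thesis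
        using * v by (intro exI[of _ p] exI[of _ "c @ [l]"] exI[of _ s]) (auto simp: inv_word_def)
    next
      case False
      then have "freely_reduced ((u @ [l]) @ v)"
        using snoc.prems unfolding freely_reduced_append[of "u @ [l]"] by auto
      then show ?thesis
        by (intro exI[of _ "u @ [l]"] exI[of _ "[]"] exI[of _ v]) (auto simp: free_reduce_id)
    qed
  qed
  then show ?thesis using that by blast
qed

section \<open>Long common factors of conjugates and of concatenations\<close>

text \<open>In \<open>u p = z u\<close> the left product cancels a prefix of \<open>p\<close> and
  the right one a suffix of \<open>z\<close>. Once the two reduced results are matched, what remains
  of \<open>z\<close> overlaps what remains of \<open>p\<close>; at most \<open>length u\<close>
  letters of \<open>p\<close> are lost at either end.\<close>

lemma conjugate_common_sublist:
  assumes "freely_reduced u" "freely_reduced p" "freely_reduced z"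
    and eq: "free_reduce (u @ p) = free_reduce (z @ u)"
    and len: "2 * length u \<le> length p"
  obtains f where "sublist f p" "sublist f z" "length p \<le> length f + 2 * length u"
proof -
  obtain u1 c s where 1: "u = u1 @ c" "p = inv_word c @ s" "free_reduce (u @ p) = u1 @ s"
    using free_reduce_append_cases assms by metis
  obtain z1 d u2 where 2: "z = z1 @ d" "u = inv_word d @ u2" "free_reduce (z @ u) = z1 @ u2"
    using free_reduce_append_cases assms by metis
  have e: "u1 @ s = z1 @ u2" using 1 2 eq by simp
  have l: "length u = length u1 + length c" "length p = length c + length s"
    "length u = length d + length u2" "length u1 + length s = length z1 + length u2"
    using arg_cong[OF 1(1), of length] arg_cong[OF 1(2), of length] arg_cong[OF 2(2), of length]
      arg_cong[OF e, of length] by simp_all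
  \<comment> \<open>\<open>s\<close> keeps at least \<open>length p - length u\<close>, hence at
    least \<open>length u\<close> letters, so it is no shorter than \<open>u2\<close>.\<close>
  then have "length u1 \<le> length z1" using len by linarith
  then obtain f where f: "z1 = u1 @ f" "s = f @ u2"
    using e by (auto simp: append_eq_append_conv2)
  show ?thesis
  proof
    show "sublist f p" using f 1 by (auto simp: sublist_def)
    show "sublist f z" using f 2 by (auto simp: sublist_def)
    show "length p \<le> length f + 2 * length u" using f l by simp
  qed
qed

text \<open>If \<open>f\<close> lies neither inside the first block nor inside the rest, the
  boundary cuts it in two, and one piece has at least \<open>t\<close> letters. A right-hand piece
  that long starts at the beginning of the next block, which is long enough to contain its first
  \<open>t\<close> letters.\<close>

lemma sublist_concat_half:
  assumes "sublist f (concat cs)" "\<forall>c \<in> set cs. t \<le> length c" "2 * t \<le> length f" "0 < t"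
  obtains c f' where "c \<in> set cs" "sublist f' f" "sublist f' c" "length f' = t"
proof -
  have "\<exists>c \<in> set cs. \<exists>f'. sublist f' f \<and> sublist f' c \<and> length f' = t"
    using assms(1-3)
  proof (induction cs)
    case Nil
    then show ?case using \<open>0 < t\<close> by simp
  next
    case (Cons c cs)
    from Cons.prems(1) consider "sublist f c" | "sublist f (concat cs)"
      | f1 f2 where "f = f1 @ f2" "suffix f1 c" "prefix f2 (concat cs)"
      by (auto simp: sublist_append)
    then show ?case
    proof cases
      case 1
      have "sublist (take t f) f" by (simp add: sublist_take)
      then show ?thesis
        using 1 Cons.prems by (intro bexI[of _ c] exI[of _ "take t f"]) (auto intro: sublist_order.order.trans)
    next
      case 2
      then show ?thesis using Cons by auto
    next
      case 3
      show ?thesis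
      proof (cases "t \<le> length f1")
        case True
        have "sublist (take t f1) f1" "sublist f1 c" "sublist f1 f"
          using 3 by (auto simp: sublist_take)
        then show ?thesis using True
          by (intro bexI[of _ c] exI[of _ "take t f1"]) (auto intro: sublist_order.order.trans)
      next
        case False
        then have len: "t \<le> length f2" using 3 Cons.prems by auto
        then obtain c' cs' where cs: "cs = c' # cs'"
          using 3 \<open>0 < t\<close> by (cases cs) auto
        have "prefix (take t f2) (c' @ concat cs')"
          using 3 cs by (auto intro: prefix_order.trans take_is_prefix)
        moreover have "prefix c' (c' @ concat cs')" by simp
        moreover have "length (take t f2) \<le> length c'" using len cs Cons.prems by simp
        ultimately have "prefix (take t f2) c'" using prefix_length_prefix by blast
        moreover have "sublist (take t f2) f2" "sublist f2 f" using 3 by (auto simp: sublist_take)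
        ultimately show ?thesis using len cs
          by (intro bexI[of _ c'] exI[of _ "take t f2"]) (auto intro: sublist_order.order.trans)
      qed
    qed
  qed
  then show ?thesis using that by blast
qed

section \<open>Block structure of the images of reduced words\<close>

definition letter_image :: "('a \<Rightarrow> 'b word) \<Rightarrow> 'a \<times> bool \<Rightarrow> 'b word" where
  "letter_image a l = (if snd l then a (fst l) else inv_word (a (fst l)))"

lemma letter_image_inv_letter: "letter_image a (inv_letter l) = inv_word (letter_image a l)"
  by (simp add: letter_image_def inv_letter_def)

lemma letter_image_in_carrier:
  "a \<in> S \<rightarrow> carrier (free_group D) \<Longrightarrow> fst l \<in> S \<Longrightarrow> letter_image a l \<in> carrier (free_group D)"
  by (auto simp: letter_image_def Pi_iff intro!: inv_word_in_carrier)

lemma free_ext_Nil: "free_ext (free_group D) a [] = []"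
  by (simp add: free_ext_def one_free_group)

lemma free_ext_Cons:
  assumes "a \<in> S \<rightarrow> carrier (free_group D)" "fst l \<in> S"
  shows "free_ext (free_group D) a (l # x) = free_reduce (letter_image a l @ free_ext (free_group D) a x)"
  using assms by (cases l) (auto simp: free_ext_def letter_image_def inv_free_group mult_free_group Pi_iff)

text \<open>Signed letters are compared because \<open>letter_image a (inv_letter l)\<close> starts
  with the inverse of the end of \<open>letter_image a l\<close>: distinct prefixes thus bound the
  cancellation between consecutive images. The factor 4 leaves at least \<open>2 * L\<close> letters
  after the losses at both ends.\<close>

definition separated :: "'a set \<Rightarrow> nat \<Rightarrow> ('a \<Rightarrow> 'b word) \<Rightarrow> bool" where
  "separated S L a \<longleftrightarrow> (\<forall>i \<in> S. 4 * L \<le> length (a i)) \<and>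
    (\<forall>l l'. fst l \<in> S \<longrightarrow> fst l' \<in> S \<longrightarrow> l \<noteq> l' \<longrightarrow>
       take L (letter_image a l) \<noteq> take L (letter_image a l'))"

text \<open>Induction prepends letters, so only the leftmost block can still be shortened. It is
  kept apart as \<open>c\<close>, which has lost letters only at its right end; the blocks in
  \<open>cs\<close> have met both neighbours.\<close>

lemma free_ext_chunks:
  assumes a: "a \<in> S \<rightarrow> carrier (free_group D)" and sep: "separated S L a"
    and x: "x \<in> carrier (free_group S)" "x \<noteq> []"
  obtains c cs where "free_ext (free_group D) a x = c @ concat cs"
    "prefix c (letter_image a (hd x))" "length (letter_image a (hd x)) \<le> length c + L"
    "length cs + 1 = length x"
    "\<And>c. c \<in> set cs \<Longrightarrow> 2 * L \<le> length c \<and> (\<exists>l. fst l \<in> S \<and> sublist c (letter_image a l))"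
proof -
  let ?g = "free_ext (free_group D) a" and ?W = "letter_image a"
  have lenW: "4 * L \<le> length (?W l)" if "fst l \<in> S" for l
    using sep that by (simp add: separated_def letter_image_def)
  have redW: "freely_reduced (?W l)" if "fst l \<in> S" for l
    using letter_image_in_carrier[OF a that] by (simp add: carrier_free_group)
  have "\<exists>c cs. ?g x = c @ concat cs \<and> prefix c (?W (hd x)) \<and> length (?W (hd x)) \<le> length c + L \<and>
      length cs + 1 = length x \<and>
      (\<forall>c \<in> set cs. 2 * L \<le> length c \<and> (\<exists>l. fst l \<in> S \<and> sublist c (?W l)))"
    using x
  proof (induction x)
    case (Cons l x)
    have l: "fst l \<in> S" and x: "x \<in> carrier (free_group S)"
      using Cons.prems by (auto simp: carrier_free_group freely_reduced_Cons)
    show ?case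
    proof (cases "x = []")
      case True
      have "?g [l] = ?W l"
        using free_ext_Cons[OF a l, of "[]"] redW[OF l] by (simp add: free_ext_Nil free_reduce_id)
      then show ?thesis using True by (intro exI[of _ "?W l"] exI[of _ "[]"]) auto
    next
      case False
      define l' where "l' = hd x"
      have l': "fst l' \<in> S" "l' \<noteq> inv_letter l"
        using x Cons.prems False
        by (cases x; auto simp: carrier_free_group freely_reduced_Cons l'_def)+
      from Cons.IH[OF x False] obtain c cs where
        gx: "?g x = c @ concat cs" and pre: "prefix c (?W l')" and len: "length (?W l') \<le> length c + L"
        and lcs: "length cs + 1 = length x"
        and cs: "\<forall>c \<in> set cs. 2 * L \<le> length c \<and> (\<exists>l. fst l \<in> S \<and> sublist c (?W l))"
        by (auto simp: l'_def)
      obtain p d s where pds: "?W l = p @ d" "?W l' = inv_word d @ s"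
        and ps: "freely_reduced (p @ s)"
        using free_reduce_append_cases redW l l' by metis
      \<comment> \<open>A cancelled piece of \<open>L\<close> letters would give
        \<open>inv_letter l\<close> and \<open>l'\<close> the same first \<open>L\<close> letters,
        although they are distinct because \<open>l # x\<close> is reduced.\<close>
      have dL: "length d < L"
      proof (rule ccontr)
        assume "\<not> length d < L"
        then have "take L (?W (inv_letter l)) = take L (?W l')"
          by (simp add: pds letter_image_inv_letter)
        moreover have "fst (inv_letter l) \<in> S" using l by (simp add: inv_letter_def)
        ultimately show False using sep l' unfolding separated_def by metis
      qed
      \<comment> \<open>\<open>c\<close> has at least \<open>3 * L\<close> letters, so the
        cancellation stays inside the first block and leaves \<open>cs\<close> untouched.\<close>
      have "length (inv_word d) < length c"
        using dL len lenW[OF l'(1)] by simp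
      moreover have "prefix (inv_word d) (?W l')" by (simp add: pds)
      ultimately have "prefix (inv_word d) c"
        using pre prefix_length_prefix by (metis less_imp_le)
      then obtain c' where c': "c = inv_word d @ c'" by (auto simp: prefix_def)
      then have c'ne: "c' \<noteq> []" using \<open>length (inv_word d) < length c\<close> by auto
      have c's: "prefix c' s" using pre c' pds by simp
      have gc: "?g x \<in> carrier (free_group D)"
        using free_ext_closed[OF group_free_group a, of x] x by (simp add: carrier_free_group)
      \<comment> \<open>Reducedness concerns adjacent letters only: two reduced words that overlap
        in the nonempty \<open>c'\<close> glue to a reduced word.\<close>
      have red: "freely_reduced (p @ c' @ concat cs)"
      proof -
        obtain s' where "s = c' @ s'" using c's by (auto simp: prefix_def)
        then have "freely_reduced ((p @ c') @ s')" using ps by simp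
        then have "freely_reduced (p @ c')" unfolding freely_reduced_append[of "p @ c'"] by blast
        moreover have "freely_reduced (c' @ concat cs)"
          using gc gx c' by (simp add: carrier_free_group freely_reduced_append)
        ultimately show ?thesis using c'ne by (auto simp: freely_reduced_append)
      qed
      have "?g (l # x) = free_reduce (p @ d @ inv_word d @ c' @ concat cs)"
        using free_ext_Cons[OF a l] gx pds c' by simp
      also have "\<dots> = free_reduce (p @ free_reduce (free_reduce (inv_word (inv_word d) @ inv_word d) @ c' @ concat cs))"
        by (simp add: free_reduce_free_reduce_left free_reduce_free_reduce_right)
      also have "free_reduce (inv_word (inv_word d) @ inv_word d) = []"
        unfolding inv_word_def[of "inv_word d"] by (rule free_reduce_inverse)
      also have "free_reduce (p @ free_reduce ([] @ c' @ concat cs)) = p @ concat (c' # cs)"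
        using red by (simp add: free_reduce_free_reduce_right free_reduce_id)
      finally have g: "?g (l # x) = p @ concat (c' # cs)" .
      have "2 * L \<le> length c'"
        using c' dL len lenW[OF l'(1)] by simp
      moreover have "sublist c' (?W l')"
      proof -
        have "sublist c' s" "sublist s (?W l')" using c's pds(2) by (simp_all add: prefix_imp_sublist)
        then show ?thesis by (rule sublist_order.order.trans)
      qed
      then have "\<exists>l. fst l \<in> S \<and> sublist c' (?W l)" using l' by blast
      ultimately show ?thesis
        using g pds dL lcs cs
        by (intro exI[of _ p] exI[of _ "c' # cs"]) (simp add: pds)
    qed
  qed simp
  then show ?thesis using that by blast
qed

text \<open>There are as many blocks as letters in \<open>x\<close>, and none is empty because
  \<open>0 < L\<close>.\<close>

lemma free_ext_length_ge:
  assumes a: "a \<in> S \<rightarrow> carrier (free_group D)" and sep: "separated S L a" and "0 < L"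
    and x: "x \<in> carrier (free_group S)"
  shows "length x \<le> length (free_ext (free_group D) a x)"
proof (cases "x = []")
  case False
  obtain c cs where gx: "free_ext (free_group D) a x = c @ concat cs"
    and len: "length (letter_image a (hd x)) \<le> length c + L"
    and lcs: "length cs + 1 = length x"
    and cs: "\<And>c. c \<in> set cs \<Longrightarrow> 2 * L \<le> length c"
    using free_ext_chunks[OF a sep x False] by metis
  have "fst (hd x) \<in> S" using x False by (cases x) (auto simp: carrier_free_group)
  then have "4 * L \<le> length (letter_image a (hd x))"
    using sep by (auto simp: separated_def letter_image_def)
  then have "1 \<le> length c" using len \<open>0 < L\<close> by linarith
  moreover have "length cs \<le> length (concat cs)"
    using cs
  proof (induction cs)
    case (Cons c cs)
    have "1 \<le> length c" using Cons.prems[of c] \<open>0 < L\<close> by simp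
    then show ?case using Cons by simp
  qed simp
  ultimately show ?thesis using gx lcs by simp
qed simp

text \<open>By \<open>free_ext_length_ge\<close> an element of the kernel has length 0, so the
  kernel is trivial.\<close>

lemma inj_on_free_ext:
  assumes a: "a \<in> S \<rightarrow> carrier (free_group D)" and sep: "separated S L a" and "0 < L"
  shows "inj_on (free_ext (free_group D) a) (carrier (free_group S))"
proof -
  interpret group_hom "free_group S" "free_group D" "free_ext (free_group D) a"
    using free_ext_hom[OF group_free_group a]
    by (intro group_hom.intro group_hom_axioms.intro group_free_group)
  show ?thesis
  proof (rule inj_onI)
    fix x y
    assume x: "x \<in> carrier (free_group S)" and y: "y \<in> carrier (free_group S)"
      and e: "free_ext (free_group D) a x = free_ext (free_group D) a y"
    let ?z = "x \<otimes>\<^bsub>free_group S\<^esub> inv\<^bsub>free_group S\<^esub> y"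
    have "free_ext (free_group D) a ?z = \<one>\<^bsub>free_group D\<^esub>"
      using x y e by simp
    then have "?z = \<one>\<^bsub>free_group S\<^esub>"
      using free_ext_length_ge[OF a sep \<open>0 < L\<close>, of ?z] x y by (simp add: one_free_group)
    then show "x = y"
      using x y by (metis G.inv_closed G.inv_equality G.inv_inv)
  qed
qed

text \<open>Every block has at least \<open>t\<close> letters, so \<open>sublist_concat_half\<close>
  applies. The length \<open>t\<close> stays variable so that the lemma serves both images in turn,
  first with \<open>2 * L\<close>, then with \<open>L\<close>.\<close>

lemma free_ext_sublist_half:
  assumes a: "a \<in> S \<rightarrow> carrier (free_group D)" and sep: "separated S L a"
    and x: "x \<in> carrier (free_group S)"
    and f: "sublist f (free_ext (free_group D) a x)" "2 * t \<le> length f"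
    and t: "0 < t" "t \<le> 2 * L"
  obtains l f' where "fst l \<in> S" "sublist f' f" "sublist f' (letter_image a l)" "length f' = t"
proof -
  have "x \<noteq> []"
    using f t by (auto simp: free_ext_Nil)
  with x obtain c cs where gx: "free_ext (free_group D) a x = c @ concat cs"
    and pre: "prefix c (letter_image a (hd x))"
    and len: "length (letter_image a (hd x)) \<le> length c + L"
    and cs: "\<And>c. c \<in> set cs \<Longrightarrow> 2 * L \<le> length c \<and> (\<exists>l. fst l \<in> S \<and> sublist c (letter_image a l))"
    using free_ext_chunks[OF a sep x] by metis
  have hd: "fst (hd x) \<in> S" using x \<open>x \<noteq> []\<close> by (cases x) (auto simp: carrier_free_group)
  then have "4 * L \<le> length (letter_image a (hd x))"
    using sep by (auto simp: separated_def letter_image_def)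
  then have *: "\<forall>c \<in> set (c # cs). t \<le> length c"
    using cs len t by fastforce
  have "sublist f (concat (c # cs))" using f gx by simp
  then obtain c' f' where "c' \<in> set (c # cs)" "sublist f' f" "sublist f' c'" "length f' = t"
    using sublist_concat_half * f t by metis
  moreover have "\<exists>l. fst l \<in> S \<and> sublist c' (letter_image a l)"
    proof (cases "c' = c")
    case True
    then show ?thesis using pre hd prefix_imp_sublist by blast
  next
    case False
    then show ?thesis using \<open>c' \<in> set (c # cs)\<close> cs by auto
  qed
  ultimately show ?thesis using that sublist_order.order.trans by blast
qed

section \<open>Conjugacy of the two images\<close>

lemma cyclically_reduced_power:
  assumes x: "x \<in> carrier (free_group S)" "x \<noteq> []" and cyc: "hd x \<noteq> inv_letter (last x)"
  shows "concat (replicate N x) \<in> carrier (free_group S)"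
proof -
  have "freely_reduced (concat (replicate N x))"
  proof (induction N)
    case (Suc N)
    have "concat (replicate N x) = [] \<or> hd (concat (replicate N x)) = hd x"
      using x by (cases N) auto
    then show ?case using Suc x cyc by (auto simp: freely_reduced_append carrier_free_group)
  qed simp
  then show ?thesis using x by (auto simp: carrier_free_group)
qed

definition share_factor :: "nat \<Rightarrow> 'a list \<Rightarrow> 'a list \<Rightarrow> bool" where
  "share_factor L u v \<longleftrightarrow> (\<exists>f. length f = L \<and> sublist f u \<and> sublist f v)"

text \<open>
  For a cyclically reduced word \<open>x\<close> and large \<open>N\<close>, conjugacy of the images of \<open>x^N\<close> yields a
  common factor of length \<open>4 * L\<close> of these images; half of it lies in a single block of the first
  image, and half of that half lies in a single block of the second one.
\<close>

lemma not_conjugate_cyclically_reduced: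
  assumes a: "a \<in> S \<rightarrow> carrier (free_group D)" and sep_a: "separated S L a"
    and b: "b \<in> S \<rightarrow> carrier (free_group D)" and sep_b: "separated S L b"
    and "0 < L"
    and share: "\<And>l l'. fst l \<in> S \<Longrightarrow> fst l' \<in> S \<Longrightarrow>
      \<not> share_factor L (letter_image a l) (letter_image b l')"
    and x: "x \<in> carrier (free_group S)" "x \<noteq> []" and cyc: "hd x \<noteq> inv_letter (last x)"
    and u: "u \<in> carrier (free_group D)"
  shows "u \<otimes>\<^bsub>free_group D\<^esub> free_ext (free_group D) a x \<noteq> free_ext (free_group D) b x \<otimes>\<^bsub>free_group D\<^esub> u"
proof
  let ?F = "free_group D"
  let ?g = "free_ext ?F a" and ?h = "free_ext ?F b"
  interpret F: group ?F by (rule group_free_group)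
  assume eq: "u \<otimes>\<^bsub>?F\<^esub> ?g x = ?h x \<otimes>\<^bsub>?F\<^esub> u"
  let ?p = "\<lambda>N. concat (replicate N x)"
  have setx: "set x \<subseteq> S \<times> UNIV" "set (?p N) \<subseteq> S \<times> UNIV" for N
    using x by (auto simp: carrier_free_group)
  note cl = free_ext_closed[OF group_free_group a] free_ext_closed[OF group_free_group b]
  have eqN: "u \<otimes>\<^bsub>?F\<^esub> ?g (?p N) = ?h (?p N) \<otimes>\<^bsub>?F\<^esub> u" for N
  proof (induction N)
    case 0
    then show ?case using u by (simp add: free_ext_def)
  next
    case (Suc N)
    have "u \<otimes>\<^bsub>?F\<^esub> ?g (?p (Suc N)) = (u \<otimes>\<^bsub>?F\<^esub> ?g x) \<otimes>\<^bsub>?F\<^esub> ?g (?p N)"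
      using free_ext_append[OF group_free_group a setx, of N] cl setx u
      by (simp add: F.m_assoc)
    also have "\<dots> = ?h x \<otimes>\<^bsub>?F\<^esub> (u \<otimes>\<^bsub>?F\<^esub> ?g (?p N))"
      using cl setx u by (simp add: eq F.m_assoc)
    also have "\<dots> = ?h (?p (Suc N)) \<otimes>\<^bsub>?F\<^esub> u"
      using free_ext_append[OF group_free_group b setx, of N] cl setx u Suc
      by (simp add: F.m_assoc)
    finally show ?case .
  qed
  \<comment> \<open>Conjugation by \<open>u\<close> costs at most \<open>2 * length u\<close>
    letters and \<open>4 * L\<close> must survive; the image is at least as long as
    \<open>y\<close>, which has at least \<open>N\<close> letters.\<close>
  define N where "N = 2 * length u + 4 * L"
  define y where "y = ?p N"
  have y: "y \<in> carrier (free_group S)"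
    using cyclically_reduced_power[OF x cyc] by (simp add: y_def)
  have "N \<le> length y"
    using x by (cases x) (simp_all add: y_def length_concat sum_list_replicate)
  then have len: "2 * length u + 4 * L \<le> length (?g y)"
    using free_ext_length_ge[OF a sep_a \<open>0 < L\<close> y] by (simp add: N_def)
  have "freely_reduced u" "freely_reduced (?g y)" "freely_reduced (?h y)"
    using u cl setx by (auto simp: y_def carrier_free_group)
  moreover have "free_reduce (u @ ?g y) = free_reduce (?h y @ u)"
    using eqN[of N] by (simp add: y_def mult_free_group)
  ultimately obtain f where f: "sublist f (?g y)" "sublist f (?h y)" "length (?g y) \<le> length f + 2 * length u"
    using conjugate_common_sublist len by (metis add_leD1)
  have "2 * (2 * L) \<le> length f" using f len by linarith
  then obtain l f1 where 1: "fst l \<in> S" "sublist f1 f" "sublist f1 (letter_image a l)" "length f1 = 2 * L"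
    using free_ext_sublist_half[OF a sep_a y f(1), of "2 * L"] \<open>0 < L\<close> by auto
  have "sublist f1 (?h y)" using 1 f sublist_order.order.trans by blast
  then obtain l' f2 where 2: "fst l' \<in> S" "sublist f2 f1" "sublist f2 (letter_image b l')" "length f2 = L"
    using free_ext_sublist_half[OF b sep_b y, of f1 L] 1 \<open>0 < L\<close> by auto
  have "sublist f2 (letter_image a l)" using 1 2 sublist_order.order.trans by blast
  then show False using share 1 2 by (auto simp: share_factor_def)
qed

text \<open>Passage to cyclically reduced words: for \<open>x = l y l^-1\<close>, an equation for
  \<open>x\<close> with conjugator \<open>u\<close> becomes one for the shorter \<open>y\<close>
  with conjugator \<open>h(l)^-1 u g(l)\<close>, so induction on the length applies. The form
  \<open>u g(x) = h(x) u\<close> is the one that \<open>conjugate_common_sublist\<close> and the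
  exponent sum use as it stands.\<close>

lemma conjugacy_inequivalent_free_ext:
  assumes a: "a \<in> S \<rightarrow> carrier (free_group D)" and b: "b \<in> S \<rightarrow> carrier (free_group D)"
    and ncr: "\<And>x u. \<lbrakk>x \<in> carrier (free_group S); x \<noteq> []; hd x \<noteq> inv_letter (last x);
        u \<in> carrier (free_group D)\<rbrakk> \<Longrightarrow>
      u \<otimes>\<^bsub>free_group D\<^esub> free_ext (free_group D) a x \<noteq> free_ext (free_group D) b x \<otimes>\<^bsub>free_group D\<^esub> u"
  shows "conjugacy_inequivalent S D (free_ext (free_group D) a) (free_ext (free_group D) b)"
proof -
  let ?F = "free_group D"
  let ?g = "free_ext ?F a" and ?h = "free_ext ?F b"
  interpret F: group ?F by (rule group_free_group)
  note cl = free_ext_closed[OF group_free_group a] free_ext_closed[OF group_free_group b]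
  have nc: "u \<otimes>\<^bsub>?F\<^esub> ?g x \<noteq> ?h x \<otimes>\<^bsub>?F\<^esub> u"
    if "x \<in> carrier (free_group S)" "x \<noteq> []" "u \<in> carrier ?F" for x u
    using that
  proof (induction "length x" arbitrary: x u rule: less_induct)
    case less
    show ?case
    proof (cases "hd x = inv_letter (last x)")
      case False
      then show ?thesis using ncr less.prems by blast
    next
      case True
      obtain l x' where x': "x = l # x'" using less.prems by (cases x) auto
      with True have "x' \<noteq> []" by auto
      then obtain y l' where "x' = y @ [l']" by (metis rev_exhaust)
      with x' True have x: "x = l # y @ [inv_letter l]" by simp
      \<comment> \<open>\<open>y\<close> is nonempty, since otherwise \<open>x\<close> would be
        \<open>l\<close> followed by its inverse.\<close>
      with less.prems have y: "y \<in> carrier (free_group S)" "y \<noteq> []" and l: "fst l \<in> S"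
        by (auto simp: carrier_free_group freely_reduced_append freely_reduced_Cons)
      have set: "set [l] \<subseteq> S \<times> UNIV" "set y \<subseteq> S \<times> UNIV" "set [inv_letter l] \<subseteq> S \<times> UNIV"
        using l y by (cases l; auto simp: carrier_free_group inv_letter_def)+
      have conj: "k x = k [l] \<otimes>\<^bsub>?F\<^esub> k y \<otimes>\<^bsub>?F\<^esub> inv\<^bsub>?F\<^esub> k [l]"
        if k: "k = free_ext ?F c" "c \<in> S \<rightarrow> carrier ?F" for k c
      proof -
        note clk = free_ext_closed[OF group_free_group k(2)]
        have "k [l] \<otimes>\<^bsub>?F\<^esub> k [inv_letter l] = k (free_reduce [l, inv_letter l])"
          using free_ext_append[OF group_free_group k(2) set(1) set(3)]
            free_ext_free_reduce[OF group_free_group k(2), of "[l, inv_letter l]"] set k(1) by simp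
        also have "\<dots> = \<one>\<^bsub>?F\<^esub>"
          by (simp add: free_reduce_def k free_ext_def)
        finally have "k [inv_letter l] = inv\<^bsub>?F\<^esub> k [l]"
          using clk set k by (metis F.inv_equality F.inv_inv)
        moreover have "k x = k [l] \<otimes>\<^bsub>?F\<^esub> (k y \<otimes>\<^bsub>?F\<^esub> k [inv_letter l])"
          using free_ext_append[OF group_free_group k(2), of "[l]" "y @ [inv_letter l]"]
            free_ext_append[OF group_free_group k(2), of y "[inv_letter l]"] set k x by simp
        ultimately show ?thesis using clk set k by (simp add: F.m_assoc)
      qed
      define A H where "A = ?g [l]" and "H = ?h [l]"
      have car: "A \<in> carrier ?F" "H \<in> carrier ?F" "?g y \<in> carrier ?F" "?h y \<in> carrier ?F" "u \<in> carrier ?F"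
        using cl set less.prems by (auto simp: A_def H_def)
      let ?u = "inv\<^bsub>?F\<^esub> H \<otimes>\<^bsub>?F\<^esub> u \<otimes>\<^bsub>?F\<^esub> A"
      show ?thesis
      proof
        assume "u \<otimes>\<^bsub>?F\<^esub> ?g x = ?h x \<otimes>\<^bsub>?F\<^esub> u"
        then have e: "u \<otimes>\<^bsub>?F\<^esub> (A \<otimes>\<^bsub>?F\<^esub> ?g y \<otimes>\<^bsub>?F\<^esub> inv\<^bsub>?F\<^esub> A) = (H \<otimes>\<^bsub>?F\<^esub> ?h y \<otimes>\<^bsub>?F\<^esub> inv\<^bsub>?F\<^esub> H) \<otimes>\<^bsub>?F\<^esub> u"
          using conj[OF refl a] conj[OF refl b] by (simp add: A_def H_def)
        have "?u \<otimes>\<^bsub>?F\<^esub> ?g y = inv\<^bsub>?F\<^esub> H \<otimes>\<^bsub>?F\<^esub> (u \<otimes>\<^bsub>?F\<^esub> (A \<otimes>\<^bsub>?F\<^esub> ?g y \<otimes>\<^bsub>?F\<^esub> inv\<^bsub>?F\<^esub> A)) \<otimes>\<^bsub>?F\<^esub> A"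
          using car by (simp add: F.m_assoc)
        also have "\<dots> = inv\<^bsub>?F\<^esub> H \<otimes>\<^bsub>?F\<^esub> (H \<otimes>\<^bsub>?F\<^esub> (?h y \<otimes>\<^bsub>?F\<^esub> ?u))"
          unfolding e using car by (simp add: F.m_assoc)
        also have "\<dots> = ?h y \<otimes>\<^bsub>?F\<^esub> ?u"
          using car by (simp add: F.m_assoc[symmetric])
        finally show False
          using less.hyps[of y ?u] y x car by simp
      qed
    qed
  qed
  show ?thesis
    unfolding conjugacy_inequivalent_def
  proof (intro ballI notI, elim bexE)
    fix u x
    assume u: "u \<in> carrier ?F" and x: "x \<in> carrier (free_group S) - {\<one>\<^bsub>free_group S\<^esub>}"
      and e: "?g x = inv\<^bsub>?F\<^esub> u \<otimes>\<^bsub>?F\<^esub> ?h x \<otimes>\<^bsub>?F\<^esub> u"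
    have "?h x \<in> carrier ?F" using x cl by (simp add: carrier_free_group)
    then have "u \<otimes>\<^bsub>?F\<^esub> ?g x = ?h x \<otimes>\<^bsub>?F\<^esub> u"
      using u unfolding e by (simp add: F.m_assoc[symmetric])
    then show False using nc u x by (auto simp: one_free_group)
  qed
qed

lemma PCP_inj_CI_separated:
  assumes "a \<in> S \<rightarrow> carrier (free_group D)" "separated S L a"
    and "b \<in> S \<rightarrow> carrier (free_group D)" "separated S L b"
    and "0 < L"
    and "\<And>l l'. fst l \<in> S \<Longrightarrow> fst l' \<in> S \<Longrightarrow>
      \<not> share_factor L (letter_image a l) (letter_image b l')"
  shows "PCP_inj_CI S D (free_ext (free_group D) a) (free_ext (free_group D) b)"
proof -
  have "conjugacy_inequivalent S D (free_ext (free_group D) a) (free_ext (free_group D) b)"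
    by (rule conjugacy_inequivalent_free_ext[OF assms(1,3)
          not_conjugate_cyclically_reduced[OF assms(1-5)]]) (use assms(6) in auto)
  then show ?thesis
    using free_ext_hom[OF group_free_group assms(1)] free_ext_hom[OF group_free_group assms(3)]
      inj_on_free_ext[OF assms(1,2,5)]
    by (simp add: PCP_inj_CI_def)
qed

section \<open>Growth of spheres and balls in the free group\<close>

definition word_sphere :: "'a set \<Rightarrow> nat \<Rightarrow> 'a word set" where
  "word_sphere D n = {w \<in> carrier (free_group D). length w = n}"

lemma word_ball_eq_spheres: "word_ball D n = (\<Union>i\<le>n. word_sphere D i)"
  by (auto simp: word_ball_def word_sphere_def)

lemma finite_word_sphere: "finite D \<Longrightarrow> finite (word_sphere D n)"
  by (rule finite_subset[OF _ finite_word_ball[of D n]]) (auto simp: word_ball_def word_sphere_def)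

lemma card_word_sphere_0: "card (word_sphere D 0) = 1"
proof -
  have "word_sphere D 0 = {[]}" by (auto simp: word_sphere_def carrier_free_group)
  then show ?thesis by simp
qed

lemma card_word_sphere_1: "card (word_sphere D (Suc 0)) = 2 * card D"
proof -
  have "word_sphere D (Suc 0) = (\<lambda>l. [l]) ` (D \<times> UNIV)"
    by (auto simp: word_sphere_def carrier_free_group length_Suc_conv freely_reduced_Cons)
  then show ?thesis by (simp add: card_image inj_on_def card_cartesian_product)
qed

text \<open>A nonempty reduced word extends on the left by any signed letter except the inverse of
  its head. The empty word has no such restriction, hence the start at length 1.\<close>

lemma card_word_sphere_Suc_Suc:
  assumes "finite D"
  shows "card (word_sphere D (Suc (Suc n))) = (2 * card D - 1) * card (word_sphere D (Suc n))"
proof -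
  let ?E = "\<lambda>w. D \<times> UNIV - {inv_letter (hd w)}"
  let ?T = "SIGMA w : word_sphere D (Suc n). ?E w"
  have "word_sphere D (Suc (Suc n)) = (\<lambda>(w, l). l # w) ` ?T"
  proof (intro equalityI subsetI)
    fix v assume "v \<in> word_sphere D (Suc (Suc n))"
    then obtain l w where "v = l # w" "w \<noteq> []" and v: "l # w \<in> word_sphere D (Suc (Suc n))"
      by (cases v; cases "tl v") (auto simp: word_sphere_def)
    then show "v \<in> (\<lambda>(w, l). l # w) ` ?T"
      by (intro image_eqI[of _ _ "(w, l)"]) (auto simp: word_sphere_def carrier_free_group freely_reduced_Cons)
  next
    fix v assume "v \<in> (\<lambda>(w, l). l # w) ` ?T"
    then show "v \<in> word_sphere D (Suc (Suc n))"
      by (auto simp: word_sphere_def carrier_free_group freely_reduced_Cons)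
  qed
  then have "card (word_sphere D (Suc (Suc n))) = card ?T"
    by (auto simp: card_image inj_on_def)
  also have "\<dots> = (\<Sum>w \<in> word_sphere D (Suc n). card (?E w))"
    using assms by (simp add: card_SigmaI finite_word_sphere)
  also have "\<dots> = (\<Sum>w \<in> word_sphere D (Suc n). 2 * card D - 1)"
  proof (rule sum.cong[OF refl])
    fix w assume "w \<in> word_sphere D (Suc n)"
    then have "inv_letter (hd w) \<in> D \<times> UNIV"
      by (cases w) (auto simp: word_sphere_def carrier_free_group inv_letter_def)
    then show "card (?E w) = 2 * card D - 1"
      using assms by (simp add: card_Diff_singleton card_cartesian_product)
  qed
  finally show ?thesis by simp
qed

lemma card_word_sphere_Suc:
  assumes "finite D"
  shows "card (word_sphere D (Suc n)) = 2 * card D * (2 * card D - 1) ^ n"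
  by (induction n) (simp_all add: card_word_sphere_1 card_word_sphere_Suc_Suc assms)

lemma card_word_sphere_ge:
  assumes "finite D" "D \<noteq> {}"
  shows "(2 * card D - 1) ^ n \<le> card (word_sphere D n)"
proof (cases n)
  case (Suc m)
  show ?thesis unfolding Suc card_word_sphere_Suc[OF assms(1)] power_Suc by (intro mult_mono) auto
qed (simp add: card_word_sphere_0)

text \<open>For nonempty \<open>D\<close>, \<open>2 * card D\<close> is at most twice
  \<open>2 * card D - 1\<close>, so the extra choice at length 1 costs only a factor 2.\<close>

lemma card_word_sphere_le:
  assumes "finite D" "D \<noteq> {}"
  shows "card (word_sphere D n) \<le> 2 * (2 * card D - 1) ^ n"
proof (cases n)
  case (Suc m)
  have "2 * card D \<le> 2 * (2 * card D - 1)" using assms by (cases "card D") auto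
  then have "2 * card D * (2 * card D - 1) ^ m \<le> 2 * (2 * card D - 1) * (2 * card D - 1) ^ m"
    by (intro mult_mono) auto
  then show ?thesis
    unfolding Suc card_word_sphere_Suc[OF assms(1)] by (simp add: mult.assoc)
qed (simp add: card_word_sphere_0)

lemma card_word_ball:
  assumes "finite D"
  shows "card (word_ball D n) = (\<Sum>i\<le>n. card (word_sphere D i))"
  unfolding word_ball_eq_spheres
  by (rule card_UN_disjoint) (use assms finite_word_sphere in \<open>auto simp: word_sphere_def\<close>)

lemma card_word_ball_le:
  assumes "finite D" "D \<noteq> {}"
  shows "card (word_ball D n) \<le> (n + 1) * (2 * (2 * card D - 1) ^ n)"
proof -
  have "1 \<le> 2 * card D - 1" using assms by (cases "card D") auto
  then have "card (word_sphere D i) \<le> 2 * (2 * card D - 1) ^ n" if "i \<le> n" for i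
    using card_word_sphere_le[OF assms, of i] power_increasing[OF that, of "2 * card D - 1"] by linarith
  then have "card (word_ball D n) \<le> (\<Sum>i\<le>n. 2 * (2 * card D - 1) ^ n)"
    unfolding card_word_ball[OF assms(1)] by (intro sum_mono) auto
  then show ?thesis by simp
qed

text \<open>The first bound is exponential when \<open>card D\<close> is at least 2; for
  \<open>card D = 1\<close> it is constant, and the linear second bound takes its place.\<close>

lemma card_word_ball_ge:
  assumes "finite D" "D \<noteq> {}"
  shows "(2 * card D - 1) ^ n \<le> card (word_ball D n)" "n + 1 \<le> card (word_ball D n)"
proof -
  have "card (word_sphere D n) \<le> card (word_ball D n)"
    by (rule card_mono[OF finite_word_ball[OF assms(1)]]) (auto simp: word_ball_eq_spheres)
  then show "(2 * card D - 1) ^ n \<le> card (word_ball D n)"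
    using card_word_sphere_ge[OF assms, of n] by linarith
  have "1 \<le> 2 * card D - 1" using assms by (cases "card D") auto
  then have "1 \<le> card (word_sphere D i)" for i
    using card_word_sphere_ge[OF assms, of i] one_le_power[of "2 * card D - 1" i] by linarith
  then have "(\<Sum>i\<le>n. 1) \<le> card (word_ball D n)"
    unfolding card_word_ball[OF assms(1)] by (intro sum_mono) auto
  then show "n + 1 \<le> card (word_ball D n)" by simp
qed

section \<open>Counting words with prescribed factors\<close>

text \<open>Once \<open>f\<close> and its position are fixed, only the \<open>p\<close> letters
  before it and the at most \<open>n - length f - p\<close> letters after it are free. The exponent
  drops by \<open>length f\<close>, at the price of a linear factor.\<close>

lemma card_fixed_factor_le:
  assumes D: "finite D" "D \<noteq> {}" and len: "p + length f \<le> n"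
  shows "card {w \<in> word_ball D n. \<exists>u v. w = u @ f @ v \<and> length u = p}
    \<le> 4 * (n + 1) * (2 * card D - 1) ^ (n - length f)" (is "card ?A \<le> _")
proof -
  let ?q = "2 * card D - 1" and ?r = "n - length f - p"
  have "?A \<subseteq> (\<lambda>(u, v). u @ f @ v) ` (word_sphere D p \<times> word_ball D ?r)"
  proof
    fix w assume "w \<in> ?A"
    then obtain u v where w: "w = u @ f @ v" "length u = p" "w \<in> word_ball D n" by blast
    then have "u \<in> carrier (free_group D)" "v \<in> carrier (free_group D)"
      using append_in_carrierD by (auto simp: word_ball_def) blast+
    then show "w \<in> (\<lambda>(u, v). u @ f @ v) ` (word_sphere D p \<times> word_ball D ?r)"
      using w by (intro image_eqI[of _ _ "(u, v)"]) (auto simp: word_sphere_def word_ball_def)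
  qed
  then have "card ?A \<le> card (word_sphere D p \<times> word_ball D ?r)"
    by (intro surj_card_le) (use D in \<open>auto intro: finite_word_ball finite_word_sphere\<close>)
  also have "\<dots> \<le> (2 * ?q ^ p) * ((?r + 1) * (2 * ?q ^ ?r))"
    unfolding card_cartesian_product
    using card_word_sphere_le[OF D, of p] card_word_ball_le[OF D, of ?r] by (rule mult_le_mono)
  also have "\<dots> = 4 * (?r + 1) * ?q ^ (p + ?r)"
    by (simp add: power_add algebra_simps)
  also have "p + ?r = n - length f" using len by simp
  also have "4 * (?r + 1) * ?q ^ (n - length f) \<le> 4 * (n + 1) * ?q ^ (n - length f)"
    by (intro mult_le_mono) auto
  finally show ?thesis .
qed

text \<open>A common factor is determined by its starting point \<open>s\<close> in the fixed word
  \<open>v\<close>, and it sits at some position \<open>p\<close> in \<open>w\<close>. There are at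
  most \<open>(n + 1)^2\<close> pairs, each treated by \<open>card_fixed_factor_le\<close>.\<close>

lemma card_share_factor_le:
  assumes D: "finite D" "D \<noteq> {}" and v: "length v \<le> n"
  shows "card {w \<in> word_ball D n. share_factor L w v}
    \<le> 4 * (n + 1) ^ 3 * (2 * card D - 1) ^ (n - L)" (is "card ?A \<le> ?R")
proof -
  let ?M = "4 * (n + 1) * (2 * card D - 1) ^ (n - L)"
  let ?B = "\<lambda>p s. {w \<in> word_ball D n. \<exists>u u'. w = u @ take L (drop s v) @ u' \<and> length u = p}"
  let ?I = "{p. p + L \<le> n}"
  let ?J = "{s. s + L \<le> length v}"
  have fin: "finite ?I" "finite ?J"
    by (rule finite_subset[of _ "{..n}"]; auto) (rule finite_subset[of _ "{..length v}"]; auto)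
  have sub: "?A \<subseteq> (\<Union>p \<in> ?I. \<Union>s \<in> ?J. ?B p s)"
  proof
    fix w assume w: "w \<in> ?A"
    then obtain f u u' s s' where f: "length f = L" "w = u @ f @ u'" "v = s @ f @ s'"
      unfolding share_factor_def sublist_def by blast
    then have "take L (drop (length s) v) = f" by simp
    then have "w \<in> ?B (length u) (length s)" "length u \<in> ?I" "length s \<in> ?J"
      using w f by (auto simp: word_ball_def)
    then show "w \<in> (\<Union>p \<in> ?I. \<Union>s \<in> ?J. ?B p s)" by blast
  qed
  have one: "card (?B p s) \<le> ?M" if "p \<in> ?I" "s \<in> ?J" for p s
    using card_fixed_factor_le[OF D, of p "take L (drop s v)" n] that by simp
  have "card ?A \<le> card (\<Union>p \<in> ?I. \<Union>s \<in> ?J. ?B p s)"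
    by (rule card_mono[OF _ sub]) (use fin D in \<open>auto simp: finite_word_ball\<close>)
  also have "\<dots> \<le> (\<Sum>p \<in> ?I. card (\<Union>s \<in> ?J. ?B p s))"
    by (rule card_UN_le[OF fin(1)])
  also have "\<dots> \<le> (\<Sum>p \<in> ?I. \<Sum>s \<in> ?J. card (?B p s))"
    by (intro sum_mono card_UN_le fin)
  also have "\<dots> \<le> (\<Sum>p \<in> ?I. \<Sum>s \<in> ?J. ?M)"
    by (intro sum_mono one)
  also have "\<dots> = card ?I * card ?J * ?M" by simp
  also have "\<dots> \<le> (n + 1) * (n + 1) * ?M"
  proof -
    have "card ?I \<le> card {..n}" by (rule card_mono) auto
    moreover have "card ?J \<le> card {..n}" by (rule card_mono) (use v in auto)
    ultimately show ?thesis by (intro mult_le_mono) auto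
  qed
  also have "\<dots> = ?R" by (simp add: power3_eq_cube algebra_simps)
  finally show ?thesis .
qed

text \<open>The last \<open>L\<close> letters invert the first \<open>L\<close>. As the two ends do
  not overlap, \<open>w = f v f^-1\<close> with \<open>f\<close> of length \<open>L\<close>, and one
  end determines the other.\<close>

lemma card_self_inverse_prefix_le:
  assumes D: "finite D" "D \<noteq> {}" and L: "2 * L \<le> n"
  shows "card {w \<in> word_ball D n. 2 * L \<le> length w \<and> take L w = take L (inv_word w)}
    \<le> 4 * (n + 1) * (2 * card D - 1) ^ (n - L)" (is "card ?A \<le> _")
proof -
  let ?q = "2 * card D - 1" and ?r = "n - 2 * L"
  have "?A \<subseteq> (\<lambda>(f, v). f @ v @ inv_word f) ` (word_sphere D L \<times> word_ball D ?r)"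
  proof
    fix w assume w: "w \<in> ?A"
    define f v s where "f = take L w" and "v = drop L (take (length w - L) w)" and "s = drop (length w - L) w"
    have "take (length w - L) w = f @ v"
    proof -
      have "L \<le> length w - L" using w by auto
      then have "take L (take (length w - L) w) = f" by (simp add: f_def min_absorb1)
      with append_take_drop_id[of L "take (length w - L) w"] show ?thesis
        unfolding v_def by argo
    qed
    then have ws: "w = f @ v @ s"
      using append_take_drop_id[of "length w - L" w] by (simp add: s_def)
    have len: "length f = L" "length s = L" using w by (auto simp: f_def s_def)
    have "take L (inv_word w) = inv_word s" by (subst ws) (simp add: len)
    then have "inv_word s = f" using w by (simp add: f_def)
    then have "s = inv_word f" by (metis inv_word_inv_word)
    then have "w = f @ v @ inv_word f" using ws by metis
    moreover have "f \<in> carrier (free_group D)" "v \<in> carrier (free_group D)"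
      using w append_in_carrierD[of f "v @ s" D] append_in_carrierD[of v s D]
      by (simp_all add: word_ball_def flip: ws)
    ultimately show "w \<in> (\<lambda>(f, v). f @ v @ inv_word f) ` (word_sphere D L \<times> word_ball D ?r)"
      using w len arg_cong[OF ws, of length]
      by (intro image_eqI[of _ _ "(f, v)"]) (auto simp: word_sphere_def word_ball_def)
  qed
  then have "card ?A \<le> card (word_sphere D L \<times> word_ball D ?r)"
    by (intro surj_card_le) (use D in \<open>auto intro: finite_word_ball finite_word_sphere\<close>)
  also have "\<dots> \<le> (2 * ?q ^ L) * ((?r + 1) * (2 * ?q ^ ?r))"
    unfolding card_cartesian_product
    using card_word_sphere_le[OF D, of L] card_word_ball_le[OF D, of ?r] by (rule mult_le_mono)
  also have "\<dots> = 4 * (?r + 1) * ?q ^ (L + ?r)"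
    by (simp add: power_add algebra_simps)
  also have "L + ?r = n - L" using L by simp
  also have "4 * (?r + 1) * ?q ^ (n - L) \<le> 4 * (n + 1) * ?q ^ (n - L)"
    by (intro mult_le_mono) auto
  finally show ?thesis .
qed

text \<open>\<open>V\<close> will hold all other coordinates of both tuples. A common prefix is a
  common factor, so the last clause serves the separation within a tuple as well as the comparison
  between tuples; the second clause handles the two signs of one generator.\<close>

definition bad_words :: "nat \<Rightarrow> 'a word set \<Rightarrow> 'a word set" where
  "bad_words L V = {w. length w < 4 * L \<or> take L w = take L (inv_word w) \<or>
     (\<exists>v \<in> V. share_factor L w v \<or> share_factor L w (inv_word v))}"

text \<open>The constant adds 2 for short words, 4 for words beginning like their inverse, and 4
  each for \<open>v\<close> and its inverse.\<close>

lemma card_bad_words_le: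
  assumes D: "finite D" "D \<noteq> {}" and V: "V \<subseteq> word_ball D n" "finite V" and L: "8 * L \<le> n"
  shows "card (bad_words L V \<inter> word_ball D n)
    \<le> (6 + 8 * card V) * ((n + 1) ^ 3 * (2 * card D - 1) ^ (n - L))"
proof -
  let ?q = "2 * card D - 1" and ?C = "{w \<in> word_ball D n. 2 * L \<le> length w \<and> take L w = take L (inv_word w)}"
  let ?S = "\<lambda>v. {w \<in> word_ball D n. share_factor L w v}"
  let ?Q = "?q ^ (n - L)"
  have q: "1 \<le> ?q" using D by (cases "card D") auto
  have n3: "n + 1 \<le> (n + 1) ^ 3" by (rule self_le_power) auto
  have sub: "bad_words L V \<inter> word_ball D n \<subseteq>
      (word_ball D (4 * L) \<union> ?C) \<union> (\<Union>v \<in> V. ?S v \<union> ?S (inv_word v))"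
    by (auto simp: bad_words_def word_ball_def)
  have "card (bad_words L V \<inter> word_ball D n) \<le>
      card ((word_ball D (4 * L) \<union> ?C) \<union> (\<Union>v \<in> V. ?S v \<union> ?S (inv_word v)))"
    by (rule card_mono[OF _ sub]) (use V D in \<open>auto simp: finite_word_ball\<close>)
  also have "\<dots> \<le> card (word_ball D (4 * L)) + card ?C + (\<Sum>v \<in> V. card (?S v) + card (?S (inv_word v)))"
    by (intro order.trans[OF card_Un_le] add_mono card_Un_le order.trans[OF card_UN_le[OF V(2)]] sum_mono)
  also have "card (word_ball D (4 * L)) \<le> 2 * ((n + 1) ^ 3 * ?Q)"
  proof -
    \<comment> \<open>Short words are few because \<open>4 * L\<close> is at most
      \<open>n - L\<close>.\<close>
    have "?q ^ (4 * L) \<le> ?Q" using q L by (intro power_increasing) auto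
    moreover have "4 * L + 1 \<le> (n + 1) ^ 3" using L n3 by linarith
    ultimately have "(4 * L + 1) * (2 * ?q ^ (4 * L)) \<le> (n + 1) ^ 3 * (2 * ?Q)"
      by (intro mult_le_mono) auto
    then show ?thesis using card_word_ball_le[OF D, of "4 * L"] by linarith
  qed
  also have "card ?C \<le> 4 * ((n + 1) ^ 3 * ?Q)"
  proof -
    have "card ?C \<le> 4 * (n + 1) * ?Q" by (rule card_self_inverse_prefix_le[OF D]) (use L in simp)
    also have "\<dots> \<le> 4 * (n + 1) ^ 3 * ?Q" using n3 by (intro mult_le_mono) auto
    finally show ?thesis by (simp add: mult.assoc)
  qed
  also have "(\<Sum>v \<in> V. card (?S v) + card (?S (inv_word v))) \<le> (\<Sum>v \<in> V. 8 * ((n + 1) ^ 3 * ?Q))"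
  proof (rule sum_mono)
    fix v assume "v \<in> V"
    then have "length v \<le> n" "length (inv_word v) \<le> n" using V by (auto simp: word_ball_def)
    from this[THEN card_share_factor_le[OF D, of _ n L]]
    show "card (?S v) + card (?S (inv_word v)) \<le> 8 * ((n + 1) ^ 3 * ?Q)" by linarith
  qed
  finally show ?thesis by (simp add: algebra_simps)
qed

section \<open>Counting tuples coordinate by coordinate\<close>

lemma card_PiE_fibre_le:
  fixes c :: nat
  assumes fin: "finite S" "finite B" and i: "i \<in> S"
    and c: "\<And>a. a \<in> (S - {i}) \<rightarrow>\<^sub>E B \<Longrightarrow> card {y \<in> B. P (a(i := y))} \<le> c"
  shows "card {a \<in> S \<rightarrow>\<^sub>E B. P a} \<le> c * card B ^ (card S - 1)"
proof -
  let ?R = "(S - {i}) \<rightarrow>\<^sub>E B"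
  let ?T = "SIGMA a : ?R. {y \<in> B. P (a(i := y))}"
  have finR: "finite ?R" using fin by (simp add: finite_PiE)
  have "{a \<in> S \<rightarrow>\<^sub>E B. P a} \<subseteq> (\<lambda>(a, y). a(i := y)) ` ?T"
  proof
    fix a assume a: "a \<in> {a \<in> S \<rightarrow>\<^sub>E B. P a}"
    have "restrict a (S - {i}) \<in> ?R" using a by (auto simp: PiE_iff)
    moreover have "(restrict a (S - {i}))(i := a i) = a"
      using a by (auto simp: fun_eq_iff PiE_iff extensional_def)
    ultimately show "a \<in> (\<lambda>(a, y). a(i := y)) ` ?T"
      using a i by (intro image_eqI[of _ _ "(restrict a (S - {i}), a i)"]) auto
  qed
  then have "card {a \<in> S \<rightarrow>\<^sub>E B. P a} \<le> card ?T"
    by (intro surj_card_le) (use finR fin in auto)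
  also have "\<dots> = (\<Sum>a \<in> ?R. card {y \<in> B. P (a(i := y))})"
    using finR fin by (simp add: card_SigmaI)
  also have "\<dots> \<le> (\<Sum>a \<in> ?R. c)" by (intro sum_mono c)
  also have "\<dots> = c * card B ^ (card S - 1)"
    using fin i by (simp add: card_PiE)
  finally show ?thesis .
qed

text \<open>A union bound over the coordinates of the first tuple: with the second tuple and the
  other coordinates fixed, the forbidden set is a fixed \<open>X V\<close> with at most
  \<open>2 * card S\<close> words in \<open>V\<close>. The factor \<open>card B\<close> on the left
  expresses the ratio without division.\<close>

lemma card_bad_pairs_le:
  fixes c :: nat
  assumes S: "finite S" and B: "finite B"
    and c: "\<And>V. V \<subseteq> B \<Longrightarrow> finite V \<Longrightarrow> card V \<le> 2 * card S \<Longrightarrow> card (X V \<inter> B) \<le> c"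
  shows "card {(a, b) \<in> (S \<rightarrow>\<^sub>E B) \<times> (S \<rightarrow>\<^sub>E B). \<exists>i \<in> S. a i \<in> X (a ` (S - {i}) \<union> b ` S)} * card B
    \<le> card S * c * (card B ^ card S * card B ^ card S)"
proof -
  let ?T = "S \<rightarrow>\<^sub>E B" and ?m = "card S" and ?k = "card B"
  let ?A = "\<lambda>b i. {a \<in> ?T. a i \<in> X (a ` (S - {i}) \<union> b ` S)}"
  let ?P = "SIGMA b : ?T. \<Union>i \<in> S. ?A b i"
  have finT: "finite ?T" using S B by (simp add: finite_PiE)
  have A: "card (?A b i) \<le> c * ?k ^ (?m - 1)" if b: "b \<in> ?T" and i: "i \<in> S" for b i
  proof (rule card_PiE_fibre_le[OF S B i])
    fix a assume a: "a \<in> (S - {i}) \<rightarrow>\<^sub>E B"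
    let ?V = "a ` (S - {i}) \<union> b ` S"
    have "card ?V \<le> card (a ` (S - {i})) + card (b ` S)" by (rule card_Un_le)
    also have "\<dots> \<le> card (S - {i}) + card S"
      using S by (intro add_mono card_image_le) auto
    also have "\<dots> \<le> 2 * card S" using S by (simp add: card_Diff1_le)
    finally have "card ?V \<le> 2 * card S" .
    moreover have "?V \<subseteq> B" using a b by (auto simp: PiE_iff)
    ultimately have "card (X ?V \<inter> B) \<le> c" using S by (intro c) auto
    \<comment> \<open>The forbidden set does not depend on the value at \<open>i\<close>, so the
      bound \<open>c\<close> covers all \<open>y\<close> at once.\<close>
    moreover have "(a(i := y)) ` (S - {i}) = a ` (S - {i})" for y by auto
    ultimately show "card {y \<in> B. (a(i := y)) i \<in> X ((a(i := y)) ` (S - {i}) \<union> b ` S)} \<le> c"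
      by (simp add: Int_def conj_commute)
  qed
  have "{(a, b) \<in> ?T \<times> ?T. \<exists>i \<in> S. a i \<in> X (a ` (S - {i}) \<union> b ` S)} \<subseteq> prod.swap ` ?P"
  proof (rule subsetI)
    fix t assume "t \<in> {(a, b) \<in> ?T \<times> ?T. \<exists>i \<in> S. a i \<in> X (a ` (S - {i}) \<union> b ` S)}"
    then show "t \<in> prod.swap ` ?P"
      by (intro image_eqI[of _ _ "prod.swap t"]) (cases t; simp)+
  qed
  then have "card {(a, b) \<in> ?T \<times> ?T. \<exists>i \<in> S. a i \<in> X (a ` (S - {i}) \<union> b ` S)} \<le> card ?P"
    by (intro surj_card_le) (use finT S in auto)
  also have "\<dots> = (\<Sum>b \<in> ?T. card (\<Union>i \<in> S. ?A b i))"
    using finT S by (simp add: card_SigmaI)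
  also have "\<dots> \<le> (\<Sum>b \<in> ?T. \<Sum>i \<in> S. card (?A b i))"
    by (intro sum_mono card_UN_le S)
  also have "\<dots> \<le> (\<Sum>b \<in> ?T. \<Sum>i \<in> S. c * ?k ^ (?m - 1))"
    by (intro sum_mono A)
  also have "\<dots> = ?k ^ ?m * (?m * (c * ?k ^ (?m - 1)))"
    using S by (simp add: card_PiE)
  finally have "card {(a, b) \<in> ?T \<times> ?T. \<exists>i \<in> S. a i \<in> X (a ` (S - {i}) \<union> b ` S)} * ?k
      \<le> ?k ^ ?m * (?m * (c * ?k ^ (?m - 1))) * ?k" by (rule mult_right_mono) simp
  \<comment> \<open>If \<open>?m = 0\<close>, both sides vanish; otherwise the spare factor
    \<open>?k\<close> restores the exponent \<open>?m\<close>.\<close>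
  also have "\<dots> = ?m * c * (?k ^ ?m * ?k ^ ?m)"
    by (cases ?m) (simp_all add: algebra_simps)
  finally show ?thesis .
qed

section \<open>From counts to limits of proportions\<close>

lemma proportion_le_1: "finite S \<Longrightarrow> finite D \<Longrightarrow> proportion S D P n \<le> 1"
proof -
  assume fin: "finite S" "finite D"
  then have "finite (image_tuples S D n)" by (simp add: image_tuples_def finite_PiE finite_word_ball)
  then have "card {(a, b) \<in> image_tuples S D n. P (free_ext (free_group D) a) (free_ext (free_group D) b)}
      \<le> card (image_tuples S D n)"
    by (intro card_mono) auto
  then show ?thesis using card_image_tuples_pos[OF fin, of n] by (simp add: proportion_def)
qed

lemma proportion_mono:
  assumes "finite S" "finite D" "\<And>g h. P g h \<Longrightarrow> Q g h"
  shows "proportion S D P n \<le> proportion S D Q n"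
proof -
  have fin: "finite (image_tuples S D n)"
    using assms by (simp add: image_tuples_def finite_PiE finite_word_ball)
  have "finite {(a, b) \<in> image_tuples S D n. Q (free_ext (free_group D) a) (free_ext (free_group D) b)}"
    by (rule finite_subset[OF _ fin]) auto
  then have "card {(a, b) \<in> image_tuples S D n. P (free_ext (free_group D) a) (free_ext (free_group D) b)}
      \<le> card {(a, b) \<in> image_tuples S D n. Q (free_ext (free_group D) a) (free_ext (free_group D) b)}"
    by (rule card_mono) (use assms(3) in auto)
  then show ?thesis unfolding proportion_def by (intro divide_right_mono) auto
qed

text \<open>A bad pair has a forbidden coordinate in one of its two tuples, so the bad proportion is
  at most twice the bound of \<open>card_bad_pairs_le\<close>. The forbidden sets \<open>X\<close>
  are left open, since the two rank cases choose different ones.\<close>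

lemma proportion_tendsto_1:
  assumes S: "finite S" and D: "finite D"
    and c: "\<And>n V. V \<subseteq> word_ball D n \<Longrightarrow> finite V \<Longrightarrow> card V \<le> 2 * card S \<Longrightarrow>
      card (X n V \<inter> word_ball D n) \<le> c n"
    and lim: "(\<lambda>n. real (card S * c n) / real (card (word_ball D n))) \<longlonglongrightarrow> 0"
    and good: "\<forall>\<^sub>F n in sequentially. \<forall>a \<in> S \<rightarrow> word_ball D n. \<forall>b \<in> S \<rightarrow> word_ball D n.
      (\<forall>i \<in> S. a i \<notin> X n (a ` (S - {i}) \<union> b ` S)) \<longrightarrow>
      (\<forall>i \<in> S. b i \<notin> X n (b ` (S - {i}) \<union> a ` S)) \<longrightarrow>
      P (free_ext (free_group D) a) (free_ext (free_group D) b)"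
  shows "proportion S D P \<longlonglongrightarrow> 1"
proof (rule tendsto_sandwich)
  let ?e = "\<lambda>n. real (card S * c n) / real (card (word_ball D n))"
  show "(\<lambda>n. 1 - 2 * ?e n) \<longlonglongrightarrow> 1"
    using tendsto_diff[OF tendsto_const tendsto_mult[OF tendsto_const lim], of 1 2] by simp
  show "\<forall>\<^sub>F n in sequentially. proportion S D P n \<le> 1"
    using proportion_le_1[OF S D] by simp
  show "\<forall>\<^sub>F n in sequentially. 1 - 2 * ?e n \<le> proportion S D P n"
    using good
  proof eventually_elim
    case (elim n)
    let ?B = "word_ball D n" and ?T = "image_tuples S D n"
    define k where "k = card ?B"
    have finB: "finite ?B" using D by (rule finite_word_ball)
    have finT: "finite ?T" using S finB by (simp add: image_tuples_def finite_PiE)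
    have k: "0 < k" using finB Nil_in_word_ball[of D n] by (auto simp: k_def card_gt_0_iff)
    have cardT: "card ?T = k ^ card S * k ^ card S"
      using S by (simp add: image_tuples_def card_cartesian_product card_PiE k_def)
    let ?G = "{(a, b) \<in> ?T. P (free_ext (free_group D) a) (free_ext (free_group D) b)}"
    let ?U = "{(a, b) \<in> (S \<rightarrow>\<^sub>E ?B) \<times> (S \<rightarrow>\<^sub>E ?B). \<exists>i \<in> S. a i \<in> X n (a ` (S - {i}) \<union> b ` S)}"
    have finU: "finite ?U" by (rule finite_subset[OF _ finT]) (auto simp: image_tuples_def)
    have U: "card ?U * k \<le> card S * c n * card ?T"
      unfolding cardT k_def by (rule card_bad_pairs_le[OF S finB c])
    \<comment> \<open>A forbidden coordinate of \<open>b\<close> is a forbidden coordinate of the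
      first tuple in the swapped pair.\<close>
    have "?T \<subseteq> ?G \<union> (?U \<union> prod.swap ` ?U)"
    proof
      fix t assume "t \<in> ?T"
      then obtain a b where t: "t = (a, b)" "a \<in> S \<rightarrow>\<^sub>E ?B" "b \<in> S \<rightarrow>\<^sub>E ?B"
        by (auto simp: image_tuples_def)
      show "t \<in> ?G \<union> (?U \<union> prod.swap ` ?U)"
      proof (cases "(a, b) \<in> ?U \<or> (b, a) \<in> ?U")
        case True
        moreover have "(b, a) \<in> ?U \<Longrightarrow> (a, b) \<in> prod.swap ` ?U"
          by (rule image_eqI[of _ _ "(b, a)"]) auto
        ultimately show ?thesis using t by blast
      next
        case False
        then have "P (free_ext (free_group D) a) (free_ext (free_group D) b)"
          using elim t by (auto simp: PiE_iff Pi_iff)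
        then show ?thesis using t by (simp add: image_tuples_def)
      qed
    qed
    moreover have "finite ?G" by (rule finite_subset[OF _ finT]) auto
    ultimately have "card ?T \<le> card (?G \<union> (?U \<union> prod.swap ` ?U))"
      using finU by (intro card_mono finite_UnI finite_imageI)
    also have "\<dots> \<le> card ?G + (card ?U + card (prod.swap ` ?U))"
      by (intro order.trans[OF card_Un_le] add_left_mono card_Un_le)
    also have "\<dots> \<le> card ?G + 2 * card ?U"
      using card_image_le[OF finU, of prod.swap] by simp
    finally have "real (card ?T) - 2 * real (card ?U) \<le> real (card ?G)" by linarith
    moreover have "real (card ?U) \<le> ?e n * real (card ?T)"
    proof -
      have "real (card ?U) * real k \<le> real (card S * c n) * real (card ?T)"
        using of_nat_mono[OF U, where 'a = real] by simp
      then show ?thesis using k unfolding k_def by (simp add: pos_le_divide_eq)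
    qed
    ultimately have "(1 - 2 * ?e n) * real (card ?T) \<le> real (card ?G)"
      unfolding left_diff_distrib mult.assoc[of 2] by linarith
    then show ?case
      using card_image_tuples_pos[OF S D, of n] unfolding proportion_def
      by (subst pos_le_divide_eq) auto
  qed
qed simp

section \<open>Target groups of rank at least two\<close>

lemma share_factor_inv_word:
  "share_factor L (inv_word u) (inv_word v) \<longleftrightarrow> share_factor L u v"
  unfolding share_factor_def
  by (metis inv_word_inv_word length_inv_word sublist_inv_word)

text \<open>Inverting both words preserves common factors, so the four sign patterns reduce to two;
  this is why \<open>bad_words\<close> compares with \<open>v\<close> and \<open>inv_word v\<close>
  only.\<close>

lemma share_factor_letter_images:
  assumes "share_factor L (letter_image a l) (letter_image b l')"
  shows "share_factor L (a (fst l)) (b (fst l')) \<or> share_factor L (a (fst l)) (inv_word (b (fst l')))"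
  using assms share_factor_inv_word[of L "a (fst l)" "b (fst l')"]
    share_factor_inv_word[of L "a (fst l)" "inv_word (b (fst l'))"]
  by (auto simp: letter_image_def split: if_splits)

text \<open>Distinct signed letters either belong to one generator with opposite signs, where an
  equal prefix is excluded by the self-inverse clause, or to different generators, where it is a
  forbidden common factor.\<close>

lemma separated_if_not_bad:
  assumes "\<forall>i \<in> S. a i \<notin> bad_words L (a ` (S - {i}) \<union> V)"
  shows "separated S L a"
proof -
  have len: "4 * L \<le> length (a i)" if "i \<in> S" for i
    using assms that by (auto simp: bad_words_def)
  have "take L (letter_image a l) \<noteq> take L (letter_image a l')"
    if l: "fst l \<in> S" "fst l' \<in> S" "l \<noteq> l'" for l l'
  proof
    assume e: "take L (letter_image a l) = take L (letter_image a l')"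
    show False
    proof (cases "fst l = fst l'")
      case True
      then have "snd l \<noteq> snd l'" using l by (auto simp: prod_eq_iff)
      then have "take L (a (fst l)) = take L (inv_word (a (fst l)))"
        using e True by (auto simp: letter_image_def split: if_splits)
      then show False using assms l by (auto simp: bad_words_def)
    next
      case False
      have "share_factor L (letter_image a l) (letter_image a l')"
        unfolding share_factor_def
      proof (intro exI conjI)
        \<comment> \<open>The image has at least \<open>4 * L\<close> letters, so
          \<open>take L\<close> does not fall short.\<close>
        show "length (take L (letter_image a l)) = L"
          using len[OF l(1)] by (auto simp: letter_image_def)
        show "sublist (take L (letter_image a l)) (letter_image a l')"
          by (simp add: e)
      qed simp
      then show False
        using share_factor_letter_images[of L a l a l'] assms l False
        by (auto simp: bad_words_def)
    qed
  qed
  then show ?thesis using len by (simp add: separated_def)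
qed

lemma PCP_inj_CI_if_not_bad:
  assumes a: "a \<in> S \<rightarrow> carrier (free_group D)" and b: "b \<in> S \<rightarrow> carrier (free_group D)"
    and "0 < L"
    and bad_a: "\<forall>i \<in> S. a i \<notin> bad_words L (a ` (S - {i}) \<union> b ` S)"
    and bad_b: "\<forall>i \<in> S. b i \<notin> bad_words L (b ` (S - {i}) \<union> a ` S)"
  shows "PCP_inj_CI S D (free_ext (free_group D) a) (free_ext (free_group D) b)"
proof (rule PCP_inj_CI_separated[OF a separated_if_not_bad[OF bad_a] b separated_if_not_bad[OF bad_b] \<open>0 < L\<close>])
  fix l l' :: "'a \<times> bool"
  assume "fst l \<in> S" "fst l' \<in> S"
  then show "\<not> share_factor L (letter_image a l) (letter_image b l')"
    using bad_a share_factor_letter_images[of L a l b l'] by (auto simp: bad_words_def)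
qed

text \<open>With \<open>q = 2 * card D - 1\<close>, which is at least 3, the forbidden words fill at
  most a cubic polynomial in \<open>n\<close> divided by \<open>q ^ (n div 8)\<close> of the
  ball.\<close>

lemma proportion_PCP_inj_CI_rank_ge_2:
  assumes S: "finite S" and D: "finite D" and k: "2 \<le> card D"
  shows "proportion S D (PCP_inj_CI S D) \<longlonglongrightarrow> 1"
proof (rule proportion_tendsto_1[OF S D])
  let ?q = "2 * card D - 1" and ?C = "6 + 16 * card S"
  let ?X = "\<lambda>n. bad_words (n div 8)" and ?c = "\<lambda>n. ?C * ((n + 1) ^ 3 * ?q ^ (n - n div 8))"
  have Dne: "D \<noteq> {}" using k by auto
  show "card (?X n V \<inter> word_ball D n) \<le> ?c n"
    if "V \<subseteq> word_ball D n" "finite V" "card V \<le> 2 * card S" for n V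
  proof -
    have "card (?X n V \<inter> word_ball D n) \<le> (6 + 8 * card V) * ((n + 1) ^ 3 * ?q ^ (n - n div 8))"
      by (rule card_bad_words_le[OF D Dne that(1,2)]) simp
    also have "\<dots> \<le> ?c n" using that(3) by (intro mult_right_mono) auto
    finally show ?thesis .
  qed
  show "\<forall>\<^sub>F n in sequentially. \<forall>a \<in> S \<rightarrow> word_ball D n. \<forall>b \<in> S \<rightarrow> word_ball D n.
      (\<forall>i \<in> S. a i \<notin> ?X n (a ` (S - {i}) \<union> b ` S)) \<longrightarrow>
      (\<forall>i \<in> S. b i \<notin> ?X n (b ` (S - {i}) \<union> a ` S)) \<longrightarrow>
      PCP_inj_CI S D (free_ext (free_group D) a) (free_ext (free_group D) b)"
    \<comment> \<open>From \<open>n = 8\<close> on, the factor length \<open>n div 8\<close> is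
      positive.\<close>
    using eventually_ge_at_top[of 8]
  proof eventually_elim
    case (elim n)
    then have "0 < n div 8" by simp
    then show ?case
      by (intro ballI impI PCP_inj_CI_if_not_bad) (auto simp: word_ball_def)
  qed
  \<comment> \<open>A bound in \<open>L = n div 8\<close> alone:
    \<open>n + 1 \<le> 8 * (L + 1)\<close> because the remainder is at most 7, and the base
    \<open>?q\<close> is replaced by 3.\<close>
  let ?f = "\<lambda>L. real (card S * ?C) * (8 * (real L + 1)) ^ 3 / 3 ^ L"
  show "(\<lambda>n. real (card S * ?c n) / real (card (word_ball D n))) \<longlonglongrightarrow> 0"
  proof -
    have "?f \<longlonglongrightarrow> 0" by real_asymp
    moreover have "filterlim (\<lambda>n::nat. n div 8) sequentially sequentially"
      by (rule filterlim_at_top_div_const_nat) simp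
    ultimately have lim: "(\<lambda>n. ?f (n div 8)) \<longlonglongrightarrow> 0" by (rule filterlim_compose)
    have "real (card S * ?c n) / real (card (word_ball D n)) \<le> ?f (n div 8)" for n
    proof -
      define L where "L = n div 8"
      have q: "3 \<le> real ?q" using k by simp
      have "real (?q ^ n) \<le> real (card (word_ball D n))"
        using card_word_ball_ge(1)[OF D Dne, of n] of_nat_mono by blast
      then have B: "real ?q ^ n \<le> real (card (word_ball D n))" by simp
      have qn: "real ?q ^ n = real ?q ^ (n - L) * real ?q ^ L"
        by (simp add: L_def flip: power_add)
      have "real (card S * ?c n) / real (card (word_ball D n)) \<le> real (card S * ?c n) / real ?q ^ n"
        using B q by (intro divide_left_mono mult_pos_pos less_le_trans[OF _ B]) auto
      also have "\<dots> = real (card S * ?C) * (real n + 1) ^ 3 / real ?q ^ L"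
      proof -
        have "real (card S * ?c n) = real (card S * ?C) * (real n + 1) ^ 3 * real ?q ^ (n - L)"
          unfolding L_def of_nat_mult of_nat_power of_nat_add of_nat_1 by (simp only: mult.assoc)
        moreover have "0 < real ?q ^ (n - L)" using q by (intro zero_less_power) linarith
        ultimately show ?thesis
          unfolding qn by (simp only: less_imp_neq[symmetric] not_False_eq_True
              mult_divide_mult_cancel_right mult.commute[of "real ?q ^ (n - L)"])
      qed
      also have "\<dots> \<le> real (card S * ?C) * (8 * (real L + 1)) ^ 3 / 3 ^ L"
      proof -
        have "n + 1 \<le> 8 * (L + 1)" unfolding L_def by presburger
        then have "real (n + 1) \<le> real (8 * (L + 1))" by (rule of_nat_mono)
        then have "real n + 1 \<le> 8 * (real L + 1)" by simp
        then show ?thesis using q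
          by (intro frac_le mult_left_mono power_mono) auto
      qed
      finally show "real (card S * ?c n) / real (card (word_ball D n)) \<le> ?f (n div 8)"
        by (simp add: L_def)
    qed
    then show ?thesis
      by (intro tendsto_sandwich[OF _ _ tendsto_const lim]) auto
  qed
qed

section \<open>Target groups of rank at most one\<close>

text \<open>The homomorphism to the integers sending every generator to 1; in rank one it identifies
  the free group with the integers.\<close>

definition exponent_sum :: "'a word \<Rightarrow> int" where
  "exponent_sum w = (\<Sum>l\<leftarrow>w. if snd l then 1 else - 1)"

lemma exponent_sum_append [simp]: "exponent_sum (u @ v) = exponent_sum u + exponent_sum v"
  by (simp add: exponent_sum_def)

lemma exponent_sum_free_reduce [simp]: "exponent_sum (free_reduce w) = exponent_sum w"
proof (induction w)
  case (Cons l w)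
  have "exponent_sum (cancel_cons l v) = (if snd l then 1 else - 1) + exponent_sum v" for v
    by (cases v) (auto simp: exponent_sum_def inv_letter_def)
  with Cons show ?case by (simp add: free_reduce_def exponent_sum_def)
qed (simp add: free_reduce_def)

lemma exponent_sum_inv_word [simp]: "exponent_sum (inv_word w) = - exponent_sum w"
  by (induction w) (auto simp: exponent_sum_def inv_word_def inv_letter_def)

text \<open>With a single generator, a letter that differs from its neighbour would be its inverse,
  which reducedness forbids. For empty \<open>w\<close> the letter \<open>l\<close> is arbitrary,
  hence the guard on its membership.\<close>

lemma word_rank_le_1:
  assumes "finite D" "card D \<le> 1" "w \<in> carrier (free_group D)"
  obtains n l where "w = replicate n l" "w \<noteq> [] \<Longrightarrow> fst l \<in> D"
proof -
  have D: "x = y" if "x \<in> D" "y \<in> D" for x y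
    using assms that by (metis One_nat_def card_le_Suc0_iff_eq)
  have "\<forall>l \<in> set w. l = hd w"
    using assms(3)
  proof (induction w)
    case (Cons l w)
    show ?case
    proof (cases w)
      case (Cons l' w')
      have w: "w \<in> carrier (free_group D)" "fst l \<in> D" "fst l' \<in> D" "l' \<noteq> inv_letter l"
        using Cons.prems Cons by (auto simp: carrier_free_group freely_reduced_Cons)
      then have "l' = l" using D[of "fst l" "fst l'"] by (auto simp: inv_letter_def prod_eq_iff)
      then show ?thesis using Cons.IH w Cons by auto
    qed simp
  qed simp
  then have "w = replicate (length w) (hd w)" by (metis replicate_length_same)
  moreover have "w \<noteq> [] \<Longrightarrow> fst (hd w) \<in> D"
    using assms(3) by (cases w) (auto simp: carrier_free_group)
  ultimately show ?thesis using that by blast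
qed

text \<open>The sign of the sum gives the sign of the repeated letter, and its absolute value the
  number of repetitions.\<close>

lemma exponent_sum_inj_rank_le_1:
  assumes D: "finite D" "card D \<le> 1"
    and v: "v \<in> carrier (free_group D)" and w: "w \<in> carrier (free_group D)"
    and e: "exponent_sum v = exponent_sum w"
  shows "v = w"
proof -
  obtain m l where v_eq: "v = replicate m l" and l: "v \<noteq> [] \<Longrightarrow> fst l \<in> D"
    using word_rank_le_1[OF D v] by metis
  obtain n l' where w_eq: "w = replicate n l'" and l': "w \<noteq> [] \<Longrightarrow> fst l' \<in> D"
    using word_rank_le_1[OF D w] by metis
  have "exponent_sum (replicate n l) = (if snd l then int n else - int n)" for n and l :: "'a \<times> bool"
    by (simp add: exponent_sum_def sum_list_replicate)
  then have eq: "(if snd l then int m else - int m) = (if snd l' then int n else - int n)"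
    using e unfolding v_eq w_eq by simp
  show ?thesis
  proof (cases "m = 0 \<or> n = 0")
    case True
    then show ?thesis using eq unfolding v_eq w_eq by (auto split: if_splits)
  next
    case False
    then have len: "m = n" "snd l = snd l'" using eq by (auto split: if_splits)
    have "fst l \<in> D" "fst l' \<in> D" using False l l' unfolding v_eq w_eq by auto
    then have "fst l = fst l'" using D by (metis One_nat_def card_le_Suc0_iff_eq)
    then have "l = l'" using len by (simp add: prod_eq_iff)
    then show ?thesis using len by (simp add: v_eq w_eq)
  qed
qed

lemma exponent_sum_free_ext:
  assumes S: "finite S" "card S \<le> 1" and a: "a \<in> S \<rightarrow> carrier (free_group D)" and s: "s \<in> S"
    and x: "set x \<subseteq> S \<times> UNIV"
  shows "exponent_sum (free_ext (free_group D) a x) = exponent_sum x * exponent_sum (a s)"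
  using x
proof (induction x)
  case Nil
  then show ?case by (simp add: free_ext_Nil exponent_sum_def)
next
  case (Cons l x)
  then have "fst l = s" using S s by (metis One_nat_def card_le_Suc0_iff_eq list.set_intros(1) mem_Times_iff subsetD)
  moreover have "exponent_sum (l # x) = (if snd l then 1 else - 1) + exponent_sum x"
    by (simp add: exponent_sum_def)
  ultimately show ?case
    using Cons free_ext_Cons[OF a, of l x] s by (auto simp: letter_image_def algebra_simps)
qed

text \<open>It suffices to forbid the empty word and the other coordinates: a nontrivial
  \<open>a s\<close> gives injectivity, and \<open>a s \<noteq> b s\<close> gives inequivalence
  because distinct integers have distinct multiples by a nonzero factor. At most
  \<open>1 + 2 * card S \<le> 3\<close> words are forbidden.\<close>

lemma proportion_PCP_inj_CI_rank_le_1: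
  assumes S: "finite S" and D: "finite D" and k: "card D \<le> 1" "card S \<le> card D"
  shows "proportion S D (PCP_inj_CI S D) \<longlonglongrightarrow> 1"
proof (rule proportion_tendsto_1[OF S D])
  have Sle: "card S \<le> 1" using k by simp
  let ?X = "\<lambda>_. insert []"
  show "card (?X n V \<inter> word_ball D n) \<le> 3"
    if "V \<subseteq> word_ball D n" "finite V" "card V \<le> 2 * card S" for n V
  proof -
    have "card (?X n V \<inter> word_ball D n) \<le> card (insert [] V)"
      using that by (intro card_mono) auto
    also have "\<dots> \<le> Suc (card V)" by (rule card_insert_le_m1) auto
    finally show ?thesis using that Sle by linarith
  qed
  show "(\<lambda>n. real (card S * 3) / real (card (word_ball D n))) \<longlonglongrightarrow> 0"
  proof (cases "D = {}")
    \<comment> \<open>The ball does not grow here, but \<open>card S \<le> card D\<close> makes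
      \<open>card S\<close>, and with it the quotient, zero.\<close>
    case True
    then show ?thesis using k by simp
  next
    case False
    have lim: "(\<lambda>n. real (card S * 3) / (real n + 1)) \<longlonglongrightarrow> 0" by real_asymp
    have "real (card S * 3) / real (card (word_ball D n)) \<le> real (card S * 3) / (real n + 1)" for n
    proof -
      have "real n + 1 \<le> real (card (word_ball D n))"
        using card_word_ball_ge(2)[OF D False, of n] by linarith
      then show ?thesis by (intro frac_le) auto
    qed
    then show ?thesis
      by (intro tendsto_sandwich[OF _ _ tendsto_const lim]) auto
  qed
  show "\<forall>\<^sub>F n in sequentially. \<forall>a \<in> S \<rightarrow> word_ball D n. \<forall>b \<in> S \<rightarrow> word_ball D n.
      (\<forall>i \<in> S. a i \<notin> ?X n (a ` (S - {i}) \<union> b ` S)) \<longrightarrow>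
      (\<forall>i \<in> S. b i \<notin> ?X n (b ` (S - {i}) \<union> a ` S)) \<longrightarrow>
      PCP_inj_CI S D (free_ext (free_group D) a) (free_ext (free_group D) b)"
  proof (intro always_eventually allI ballI impI)
    fix n a b
    assume "a \<in> S \<rightarrow> word_ball D n" "b \<in> S \<rightarrow> word_ball D n"
      and bad: "\<forall>i \<in> S. a i \<notin> ?X n (a ` (S - {i}) \<union> b ` S)"
    then have a: "a \<in> S \<rightarrow> carrier (free_group D)" and b: "b \<in> S \<rightarrow> carrier (free_group D)"
      by (auto simp: word_ball_def)
    have nonempty: "\<exists>s. s \<in> S" if "x \<in> carrier (free_group S)" "x \<noteq> []" for x
      using that by (cases x) (auto simp: carrier_free_group)
    have ab: "a s \<noteq> []" "a s \<noteq> b s" if "s \<in> S" for s using bad that by auto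
    have "inj_on (free_ext (free_group D) a) (carrier (free_group S))"
    proof (rule inj_onI)
      fix x y
      assume x: "x \<in> carrier (free_group S)" and y: "y \<in> carrier (free_group S)"
        and e: "free_ext (free_group D) a x = free_ext (free_group D) a y"
      show "x = y"
      proof (cases "S = {}")
        case True
        then show ?thesis using x y by (simp add: carrier_free_group)
      next
        case False
        then obtain s where s: "s \<in> S" by blast
        have "a s \<in> carrier (free_group D)" using a s by auto
        then have "exponent_sum (a s) \<noteq> 0"
          using exponent_sum_inj_rank_le_1[OF D k(1), of "a s" "[]"] ab(1)[OF s]
          by (auto simp: exponent_sum_def carrier_free_group)
        moreover have "exponent_sum x * exponent_sum (a s) = exponent_sum y * exponent_sum (a s)"
          using exponent_sum_free_ext[OF S Sle a s] e x y by (metis carrier_free_group)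
        ultimately show ?thesis
          using exponent_sum_inj_rank_le_1[OF S Sle x y] by simp
      qed
    qed
    moreover have "conjugacy_inequivalent S D (free_ext (free_group D) a) (free_ext (free_group D) b)"
    proof (rule conjugacy_inequivalent_free_ext[OF a b], rule notI)
      fix x u
      assume x: "x \<in> carrier (free_group S)" "x \<noteq> []"
        and e: "u \<otimes>\<^bsub>free_group D\<^esub> free_ext (free_group D) a x = free_ext (free_group D) b x \<otimes>\<^bsub>free_group D\<^esub> u"
      obtain s where s: "s \<in> S" using nonempty x by blast
      \<comment> \<open>The contribution of \<open>u\<close> is the same on both sides and
        cancels.\<close>
      have "exponent_sum (free_ext (free_group D) a x) = exponent_sum (free_ext (free_group D) b x)"
        using arg_cong[OF e, of exponent_sum] by (simp add: mult_free_group)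
      then have "exponent_sum x * exponent_sum (a s) = exponent_sum x * exponent_sum (b s)"
        using exponent_sum_free_ext[OF S Sle a s] exponent_sum_free_ext[OF S Sle b s] x
        by (metis carrier_free_group)
      moreover have "exponent_sum x \<noteq> 0"
        using exponent_sum_inj_rank_le_1[OF S Sle x(1), of "[]"] x(2)
        by (auto simp: exponent_sum_def carrier_free_group)
      ultimately have "exponent_sum (a s) = exponent_sum (b s)" by simp
      moreover have "a s \<in> carrier (free_group D)" "b s \<in> carrier (free_group D)" using a b s by auto
      ultimately show False
        using exponent_sum_inj_rank_le_1[OF D k(1)] ab(2)[OF s] by blast
    qed
    ultimately show "PCP_inj_CI S D (free_ext (free_group D) a) (free_ext (free_group D) b)"
      using free_ext_hom[OF group_free_group a] free_ext_hom[OF group_free_group b]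
      by (simp add: PCP_inj_CI_def)
  qed
qed

theorem theorem3:
  fixes S :: "'a set" and D :: "'b set"
  assumes "finite S" and "finite D" and "card S \<le> card D"
  shows "proportion S D (PCP_inj_CI S D) \<longlonglongrightarrow> 1 \<and>
         proportion S D (conjugacy_inequivalent S D) \<longlonglongrightarrow> 1"
proof
  show 1: "proportion S D (PCP_inj_CI S D) \<longlonglongrightarrow> 1"
    using assms proportion_PCP_inj_CI_rank_ge_2 proportion_PCP_inj_CI_rank_le_1
    by (metis One_nat_def Suc_1 not_less_eq_eq)
  show "proportion S D (conjugacy_inequivalent S D) \<longlonglongrightarrow> 1"
  proof (rule tendsto_sandwich[OF _ _ 1 tendsto_const])
    show "\<forall>\<^sub>F n in sequentially.
        proportion S D (PCP_inj_CI S D) n \<le> proportion S D (conjugacy_inequivalent S D) n"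
      using assms by (intro always_eventually allI proportion_mono) (auto simp: PCP_inj_CI_def)
    show "\<forall>\<^sub>F n in sequentially. proportion S D (conjugacy_inequivalent S D) n \<le> 1"
      using assms by (intro always_eventually allI proportion_le_1)
  qed
qed

end
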